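(* On the space $L$ we have $$\widehat{x}(z_1)\widehat{x}(z_2)=\widehat{x}(z_2)\widehat{x}(z_1)=(z_1-z_2)^2:\!\widehat{x}(z_1)\widehat{x}(z_2)\!:.$$
   Context: Let $q$ be an indeterminate, $F=\mathbb{C}(q^{1/2})$, $[m]=\frac{q^m-q^{-m}}{q-q^{-1}}$. Let $K(1)=F[a(-1),a(-2),\dots]$ be the polynomial algebra on which $a(-r)$ ($r\ge1$) acts by multiplication and $a(r)$ ($r\ge1$) acts as the derivation with $a(r)\cdot a(-s)=\delta_{rs}\frac{[2r][r]}{r}$. Let $P=\mathbb{Z}\lambda$, $\alpha=2\lambda$, $(\alpha,\alpha)=2$; $F\{P\}$ is the group algebra with basis $e^\mu$; $L=K(1)\otimes F\{P\}$; $z^{\partial_\alpha}e^\beta=z^{(\alpha,\beta)}e^\beta$. Define $$x^+(z)=\exp\Big(\sum_{r\ge1}\tfrac{q^{-r/2}}{[r]}a(-r)z^r\Big)\exp\Big(-\sum_{r\ge1}\tfrac{q^{-r/2}}{[r]}a(r)z^{-r}\Big)\otimes e^\alpha z^{\partial_\alpha},$$ $$\widehat{k}(z)=\exp\Big((q-q^{-1})\sum_{r\ge1}\tfrac{-q^{r/2}}{1+q^{2r}}a(r)z^{-r}\Big),\qquad \widehat{x}(z)=x^+(z)\widehat{k}(z)\in\mathrm{Hom}(L,L((z))).$$ The normal ordering $:\ :$ places all $a(-r)$, $r\ge1$, to the left of all $a(r)$, $r\ge1$, and all $e^\alpha$ to the left of all $z_j^{\partial_\alpha}$. *)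

theory Defs
  imports
    Complex_Main
    "HOL-Library.Poly_Mapping"
    "HOL-Library.Product_Plus"
    "HOL-Computational_Algebra.Polynomial"
    "HOL-Computational_Algebra.Fraction_Field"
begin

type_synonym F = "complex poly fract"

definition qhalf :: F
  where "qhalf = Fract [:0, 1:] 1"

definition q :: F
  where "q = qhalf ^ 2"

definition qint :: "int \<Rightarrow> F"
  where "qint m = (q powi m - q powi (- m)) / (q - inverse q)"

text \<open>
  The polynomial algebra \<open>K(1)\<close> is the monoid algebra of the free commutative monoid
  \<^typ>\<open>nat \<Rightarrow>\<^sub>0 nat\<close>; the generator \<open>a(-r)\<close>, \<open>r \<ge> 1\<close>, is the variable with index
  \<open>r - 1\<close>, so that there is no variable for \<open>r = 0\<close>.  The weight \<open>k \<lambda>\<close> in \<open>P = \<int>\<lambda>\<close> is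
  encoded as the integer \<open>k\<close>, hence \<open>\<alpha>\<close> as \<open>2\<close>, and \<open>K(1) \<otimes> F{P}\<close> is the group algebra of
  \<open>P\<close> with coefficients in \<open>K(1)\<close>.
\<close>

type_synonym K1 = "(nat \<Rightarrow>\<^sub>0 nat) \<Rightarrow>\<^sub>0 F"

type_synonym L = "int \<Rightarrow>\<^sub>0 K1"

definition gen :: "nat \<Rightarrow> K1"
  where "gen r = Poly_Mapping.single (Poly_Mapping.single (r - 1) 1) 1"

definition scale :: "F \<Rightarrow> L \<Rightarrow> L"
  where "scale c v = Poly_Mapping.single 0 (Poly_Mapping.single 0 c) * v"

definition pdiff :: "nat \<Rightarrow> K1 \<Rightarrow> K1"
  where "pdiff i p =
    (\<Sum>m\<in>Poly_Mapping.keys p.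
      Poly_Mapping.single (m - Poly_Mapping.single i 1)
        (of_nat (Poly_Mapping.lookup m i) * Poly_Mapping.lookup p m))"

definition heis_deriv :: "nat \<Rightarrow> K1 \<Rightarrow> K1"
  where "heis_deriv r p =
    Poly_Mapping.single 0 (qint (2 * int r) * qint (int r) / of_nat r) * pdiff (r - 1) p"

text \<open>
  The operator \<open>a(k) \<otimes> 1\<close> on \<open>L\<close>.  There is no \<open>a(0)\<close>; the value at \<open>k = 0\<close> is a dummy.
\<close>

definition heis :: "int \<Rightarrow> L \<Rightarrow> L"
  where "heis k v =
    (if k < 0 then Poly_Mapping.single 0 (gen (nat (- k))) * v
     else if k > 0 then Poly_Mapping.map (heis_deriv (nat k)) v
     else 0)"

text \<open>
  The facts \<open>heis_deriv_add\<close>, \<open>heis_deriv_mult\<close>, \<open>heis_deriv_const\<close> and \<open>heis_deriv_gen\<close>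
  below confirm that \<^const>\<open>heis_deriv\<close> is the \<open>F\<close>-linear derivation of \<open>K(1)\<close> with
  \<open>a(r) \<cdot> a(-s) = \<delta>\<^sub>r\<^sub>s [2r][r]/r\<close>.
\<close>

lemma pdiff_superset:
  assumes "finite S" "Poly_Mapping.keys p \<subseteq> S"
  shows "pdiff i p = (\<Sum>m\<in>S. Poly_Mapping.single (m - Poly_Mapping.single i 1)
        (of_nat (Poly_Mapping.lookup m i) * Poly_Mapping.lookup p m))"
  unfolding pdiff_def using assms
  by (intro sum.mono_neutral_left) (auto simp: in_keys_iff)

lemma pdiff_single:
  "pdiff i (Poly_Mapping.single m c) =
    Poly_Mapping.single (m - Poly_Mapping.single i 1) (of_nat (Poly_Mapping.lookup m i) * c)"
  by (subst pdiff_superset[of "{m}"]) auto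

lemma pdiff_add: "pdiff i (p + p') = pdiff i p + pdiff i p'"
proof -
  let ?S = "Poly_Mapping.keys p \<union> Poly_Mapping.keys p'"
  have "Poly_Mapping.keys (p + p') \<subseteq> ?S"
    by (rule Poly_Mapping.keys_add)
  then show ?thesis
    by (simp add: pdiff_superset[of ?S] lookup_add distrib_left single_add sum.distrib)
qed

lemma pdiff_mult_single:
  "pdiff i (Poly_Mapping.single m c * Poly_Mapping.single n d) =
    pdiff i (Poly_Mapping.single m c) * Poly_Mapping.single n d
      + Poly_Mapping.single m c * pdiff i (Poly_Mapping.single n d)"
proof -
  let ?e = "Poly_Mapping.single i (1::nat)"
  have shift: "(k - ?e) + l = k + l - ?e" if "Poly_Mapping.lookup k i > 0"
    for k l :: "nat \<Rightarrow>\<^sub>0 nat"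
    by (rule poly_mapping_eqI) (use that in \<open>auto simp: lookup_add lookup_minus lookup_single when_def\<close>)
  have 1: "pdiff i (Poly_Mapping.single m c) * Poly_Mapping.single n d =
      Poly_Mapping.single (m + n - ?e) (of_nat (Poly_Mapping.lookup m i) * (c * d))"
    by (cases "Poly_Mapping.lookup m i > 0")
       (simp_all del: One_nat_def add: pdiff_single mult_single shift mult.assoc)
  have 2: "Poly_Mapping.single m c * pdiff i (Poly_Mapping.single n d) =
      Poly_Mapping.single (m + n - ?e) (of_nat (Poly_Mapping.lookup n i) * (c * d))"
    by (cases "Poly_Mapping.lookup n i > 0")
       (simp_all del: One_nat_def add: pdiff_single mult_single shift[of n m] add.commute[of m] mult.left_commute)
  show ?thesis
    unfolding 1 2
    by (simp add: mult_single pdiff_single lookup_add distrib_right single_add)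
qed

lemma single_sum_induct [case_names zero single add]:
  fixes p :: "'a \<Rightarrow>\<^sub>0 'b::comm_monoid_add"
  assumes "P 0" and "\<And>m c. P (Poly_Mapping.single m c)"
    and "\<And>p p'. P p \<Longrightarrow> P p' \<Longrightarrow> P (p + p')"
  shows "P p"
proof (induction p rule: update_induct)
  case const
  show ?case by fact
next
  case (update f m c)
  have "Poly_Mapping.update m c f = Poly_Mapping.single m c + f"
    by (rule poly_mapping_eqI)
       (use update in \<open>auto simp: lookup_update lookup_add lookup_single when_def in_keys_iff\<close>)
  then show ?case
    using assms(2,3) update by metis
qed

lemma pdiff_mult: "pdiff i (p * p') = pdiff i p * p' + p * pdiff i p'"
proof (induction p rule: single_sum_induct)
  case zero
  show ?case by (simp add: pdiff_def)
next
  case (single m c)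
  show ?case
  proof (induction p' rule: single_sum_induct)
    case zero
    show ?case by (simp add: pdiff_def)
  next
    case (single n d)
    show ?case by (rule pdiff_mult_single)
  next
    case (add p p')
    then show ?case by (simp add: pdiff_add distrib_left)
  qed
next
  case (add p p')
  then show ?case by (simp add: pdiff_add distrib_right)
qed

lemma heis_deriv_add: "heis_deriv r (p + p') = heis_deriv r p + heis_deriv r p'"
  by (simp add: heis_deriv_def pdiff_add distrib_left)

lemma heis_deriv_mult: "heis_deriv r (p * p') = heis_deriv r p * p' + p * heis_deriv r p'"
  by (simp add: heis_deriv_def pdiff_mult distrib_left mult_ac)

lemma heis_deriv_const: "heis_deriv r (Poly_Mapping.single 0 c) = 0"
  by (simp add: heis_deriv_def pdiff_single)

lemma heis_deriv_gen:
  assumes "r \<ge> 1" "s \<ge> 1"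
  shows "heis_deriv r (gen s) =
    (if r = s then Poly_Mapping.single 0 (qint (2 * int r) * qint (int r) / of_nat r) else 0)"
  using assms
  by (auto simp: heis_deriv_def gen_def pdiff_single mult_single lookup_single when_def)

text \<open>
  A formal series with coefficients in \<open>End(L)\<close> is represented by its coefficient family:
  \<open>A n v\<close> is the coefficient of \<open>z\<^sup>n\<close> in \<open>A(z) v\<close>.  The exponents lie in \<^typ>\<open>int\<close> for one
  variable and in \<^typ>\<open>int \<times> int\<close> for the two variables \<open>z\<^sub>1, z\<^sub>2\<close>.

  A product of two series is formed coefficientwise on each vector.  All sums over exponents
  that occur below have only finitely many nonzero terms once they are applied to a vector
  (annihilation operators are locally nilpotent, and only positive powers accompany creation
  operators), so that \<^const>\<open>Sum_any\<close>, the sum of finitely supported families, is the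
  intended sum.
\<close>

type_synonym 'e series = "'e \<Rightarrow> L \<Rightarrow> L"

definition sone :: "('e::ab_group_add) series"
  where "sone n v = (if n = 0 then v else 0)"

definition smul :: "('e::ab_group_add) series \<Rightarrow> 'e series \<Rightarrow> 'e series"  (infixr \<open>\<star>\<close> 70)
  where "(A \<star> B) n v = Sum_any (\<lambda>i. A i (B (n - i) v))"

definition sprod :: "('e::ab_group_add) series list \<Rightarrow> 'e series"
  where "sprod As = foldr (\<star>) As sone"

definition spow :: "('e::ab_group_add) series \<Rightarrow> nat \<Rightarrow> 'e series"
  where "spow A k = sprod (replicate k A)"

definition sexp :: "('e::ab_group_add) series \<Rightarrow> 'e series"
  where "sexp A n v = Sum_any (\<lambda>k::nat. scale (1 / of_nat (fact k)) (spow A k n v))"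

text \<open>
  The factors of a vertex operator in one variable \<open>z\<close>:
  \<^item> \<open>Creation c\<close> is \<open>exp (\<Sum>\<^sub>r\<^sub>\<ge>\<^sub>1 c\<^sub>r a(-r) z\<^sup>r)\<close>,
  \<^item> \<open>Annihilation c\<close> is \<open>exp (\<Sum>\<^sub>r\<^sub>\<ge>\<^sub>1 c\<^sub>r a(r) z\<^sup>-\<^sup>r)\<close>,
  \<^item> \<open>Lattice\<close> is \<open>e\<^sup>\<alpha>\<close>,
  \<^item> \<open>Grading\<close> is \<open>z\<close> to the power \<open>\<partial>\<^sub>\<alpha>\<close>, whose \<open>n\<close>-th coefficient projects onto the span of
    the \<open>e\<^sup>\<beta>\<close> with \<open>(\<alpha>, \<beta>) = n\<close>.  For \<open>\<beta> = k \<lambda>\<close> one has \<open>(\<alpha>, \<beta>) = k\<close>.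

  They are kept as syntax because normal ordering is an operation on expressions and not on
  the operators they denote.
\<close>

datatype factor = Creation "nat \<Rightarrow> F" | Annihilation "nat \<Rightarrow> F" | Lattice | Grading

fun factor_series :: "factor \<Rightarrow> int series"
  where
    "factor_series (Creation c) =
      sexp (\<lambda>n v. if n \<ge> 1 then scale (c (nat n)) (heis (- n) v) else 0)"
  | "factor_series (Annihilation c) =
      sexp (\<lambda>n v. if n \<le> - 1 then scale (c (nat (- n))) (heis (- n) v) else 0)"
  | "factor_series Lattice =
      (\<lambda>n v. if n = 0 then Poly_Mapping.single 2 1 * v else 0)"
  | "factor_series Grading =
      (\<lambda>n v. Poly_Mapping.single n (Poly_Mapping.lookup v n))"

definition x_plus_factors :: "factor list"
  where "x_plus_factors =
    [Creation (\<lambda>r. qhalf powi (- int r) / qint (int r)),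
     Annihilation (\<lambda>r. - (qhalf powi (- int r) / qint (int r))),
     Lattice, Grading]"

definition k_hat_factors :: "factor list"
  where "k_hat_factors =
    [Annihilation (\<lambda>r. (q - inverse q) * (- (qhalf ^ r) / (1 + q ^ (2 * r))))]"

definition x_plus :: "int series"
  where "x_plus = sprod (map factor_series x_plus_factors)"

definition k_hat :: "int series"
  where "k_hat = sprod (map factor_series k_hat_factors)"

definition x_hat :: "int series"
  where "x_hat = x_plus \<star> k_hat"

definition x_hat_factors :: "factor list"
  where "x_hat_factors = x_plus_factors @ k_hat_factors"

datatype var = Z1 | Z2

fun at_var :: "var \<Rightarrow> int series \<Rightarrow> (int \<times> int) series"
  where
    "at_var Z1 A = (\<lambda>(m, n) v. if n = 0 then A m v else 0)"
  | "at_var Z2 A = (\<lambda>(m, n) v. if m = 0 then A n v else 0)"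

definition zvar :: "var \<Rightarrow> (int \<times> int) series"
  where "zvar z = at_var z (\<lambda>n v. if n = 1 then v else 0)"

definition z1_minus_z2 :: "(int \<times> int) series"
  where "z1_minus_z2 = (\<lambda>e v. zvar Z1 e v - zvar Z2 e v)"

text \<open>
  Normal ordering sorts (stably) the factors of an expression.  The Heisenberg and the lattice
  factors act on different tensor factors of \<open>L\<close>, so their relative position is immaterial.
\<close>

fun rank :: "factor \<Rightarrow> nat"
  where
    "rank (Creation c) = 0"
  | "rank (Annihilation c) = 1"
  | "rank Lattice = 2"
  | "rank Grading = 3"

definition normal_order :: "(var \<times> factor) list \<Rightarrow> (var \<times> factor) list"
  where "normal_order ws = sort_key (\<lambda>(z, f). rank f) ws"

definition normal_product :: "(var \<times> factor) list \<Rightarrow> (int \<times> int) series"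
  where "normal_product ws =
    sprod (map (\<lambda>(z, f). at_var z (factor_series f)) (normal_order ws))"

end

theory Submission
  imports Defs "HOL-Computational_Algebra.Formal_Power_Series"
begin

text \<open>
  The exponentials are power series over the ring of \<open>F\<close>-linear endomorphisms of \<open>L\<close>, each
  characterised by the linear differential equation \<open>X' = D' X\<close> with \<open>X(0) = 1\<close>.  Uniqueness of
  the solution turns the Heisenberg relation first into the translation rule
  \<open>B(w) a(-s) = (a(-s) + g\<^sub>s w\<^sup>s) B(w)\<close> for a product \<open>B\<close> of annihilation exponentials, and then,
  since \<open>b\<^sub>s g\<^sub>s = -2/s\<close> for the coefficients at hand, into \<open>B(w) C(z) = (1 - z w)\<^sup>2 C(z) B(w)\<close>.
  With \<open>w = 1/z\<^sub>1\<close>, \<open>z = z\<^sub>2\<close> the missing factor \<open>z\<^sub>1\<^sup>2\<close> arises when the grading operator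
  in \<open>z\<^sub>1\<close> moves past \<open>e\<^sup>\<alpha>\<close>.  The normally ordered product is symmetric because creation
  operators commute among themselves, and so do annihilation operators.
\<close>

text \<open>\<open>k_hat\<close> repairs the contraction. Inside \<open>x_plus\<close>, annihilation
  against creation contributes -(1 + q^(-2r))/r, which by itself leads to (z1 - z2)(z1 - q^(-2) z2)
  and is not symmetric. The operators of \<open>k_hat\<close> add -(1 - q^(-2r))/r, so q drops out
  and both roots coincide. With differential equations only the commutator with one generator at a
  time is needed, and no rearrangement of double exponential sums. The obstacle is finiteness.
  \<open>Sum_any\<close> returns 0 on a family of infinite support, so products of series can be
  neither added nor reassociated freely, and a creation exponential may produce infinitely many
  powers of z on one vector. Local finiteness of the annihilation part is therefore carried along,
  and the operator identities are evaluated coefficient by coefficient on vectors of a fixed weight,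
  then extended to all of \<open>L\<close> by additivity.\<close>

unbundle fps_syntax

section \<open>Linear endomorphisms and exponential power series\<close>

text \<open>Solving the equation coefficientwise only requires cancelling n + 1, which makes sense
  without commutativity or division. The condition passes to power series, so uniqueness is
  available in one variable and, with coefficients in \<open>endo fps\<close>, in two.\<close>

class torsion_free_ring_1 = ring_1 +
  assumes of_nat_Suc_mult_eq_0: "of_nat (Suc n) * x = 0 \<Longrightarrow> x = 0"

instance fps :: (torsion_free_ring_1) torsion_free_ring_1
proof
  fix n and x :: "'a fps"
  assume "of_nat (Suc n) * x = 0"
  then have "of_nat (Suc n) * x $ k = 0" for k
    by (metis fps_mult_left_const_nth fps_of_nat fps_zero_nth)
  then have "x $ k = 0" for k
    by (rule of_nat_Suc_mult_eq_0)
  then show "x = 0"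
    by (simp add: fps_eq_iff)
qed

text \<open>The coefficient of \<open>U * Z\<close> at m involves only coefficients of
  \<open>Z\<close> up to m, while the derivative yields m + 1 times the next one; so the difference
  \<open>Z\<close> vanishes inductively.\<close>

lemma fps_linear_ode_unique:
  fixes X Y U :: "'a::torsion_free_ring_1 fps"
  assumes X: "fps_deriv X = U * X" and Y: "fps_deriv Y = U * Y" and "X $ 0 = Y $ 0"
  shows "X = Y"
proof -
  define Z where "Z = X - Y"
  have Z: "fps_deriv Z = U * Z"
    by (simp add: Z_def X Y right_diff_distrib)
  have "Z $ n = 0" for n
  proof (induction n rule: less_induct)
    case (less n)
    show ?case
    proof (cases n)
      case 0
      then show ?thesis using assms(3) by (simp add: Z_def)
    next
      case (Suc m)
      have "of_nat (Suc m) * Z $ Suc m = fps_deriv Z $ m"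
        by simp
      also have "\<dots> = 0"
        unfolding Z fps_mult_nth using less Suc by (auto intro!: sum.neutral)
      finally show ?thesis
        unfolding Suc by (rule of_nat_Suc_mult_eq_0)
    qed
  qed
  then show ?thesis
    by (simp add: Z_def fps_eq_iff)
qed

text \<open>The product rule leaves D' between powers of D; the hypothesis moves it to the
  front.\<close>

lemma fps_deriv_power_commuting:
  fixes D :: "'a::ring_1 fps"
  assumes "D * fps_deriv D = fps_deriv D * D"
  shows "fps_deriv (D ^ Suc k) = of_nat (Suc k) * (fps_deriv D * D ^ k)"
proof (induction k)
  case (Suc k)
  have "D * (of_nat (Suc k) * (fps_deriv D * D ^ k)) = of_nat (Suc k) * (D * fps_deriv D * D ^ k)"
    by (metis mult.assoc mult_of_nat_commute)
  also have "\<dots> = of_nat (Suc k) * (fps_deriv D * D ^ Suc k)"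
    by (simp add: assms mult.assoc)
  finally have step: "D * (of_nat (Suc k) * (fps_deriv D * D ^ k)) =
    of_nat (Suc k) * (fps_deriv D * D ^ Suc k)" .
  have "fps_deriv (D ^ Suc (Suc k)) = D * fps_deriv (D ^ Suc k) + fps_deriv D * D ^ Suc k"
    by (subst power_Suc) (rule fps_deriv_mult)
  also have "\<dots> = of_nat (Suc (Suc k)) * (fps_deriv D * D ^ Suc k)"
    unfolding Suc step by (simp add: distrib_right)
  finally show ?case .
qed simp

section \<open>The ring of F-linear endomorphisms\<close>

lemma scale_add_right: "scale c (u + v) = scale c u + scale c v"
  by (simp add: scale_def distrib_left)

lemma scale_add_left: "scale (c + d) v = scale c v + scale d v"
  by (simp add: scale_def distrib_right single_add)

lemma scale_scale: "scale c (scale d v) = scale (c * d) v"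
  by (simp add: scale_def mult_single flip: mult.assoc)

lemma scale_zero_right [simp]: "scale c 0 = 0"
  by (simp add: scale_def)

lemma scale_one [simp]: "scale 1 v = v"
  by (simp add: scale_def)

lemma scale_mult_right: "scale c (u * v) = u * scale c v"
  by (simp add: scale_def mult.left_commute)

text \<open>Linear maps form a ring under composition, whereas arbitrary functions on
  \<open>L\<close> violate one distributive law. As a type of class \<open>ring_1\<close> they can
  be coefficients of formal power series.\<close>

typedef endo = "{f :: L \<Rightarrow> L. (\<forall>u v. f (u + v) = f u + f v) \<and> (\<forall>c v. f (scale c v) = scale c (f v))}"
  morphisms ap Endo
  by (rule exI[of _ "\<lambda>v. v"]) simp

setup_lifting type_definition_endo

lemma ap_add [simp]: "ap f (u + v) = ap f u + ap f v"
  by transfer simp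

lemma ap_zero [simp]: "ap f 0 = 0"
  using ap_add[of f 0 0] add_left_imp_eq[of "ap f 0" 0 "ap f 0"] by auto

lemma ap_uminus [simp]: "ap f (- v) = - ap f v"
  by (metis ap_add ap_zero add.right_inverse minus_unique)

lemma ap_diff [simp]: "ap f (u - v) = ap f u - ap f v"
  by (metis ap_add ap_uminus uminus_add_conv_diff add.commute)

lemma ap_sum: "ap f (sum g S) = (\<Sum>i\<in>S. ap f (g i))"
  by (induction S rule: infinite_finite_induct) simp_all

lemma endo_eqI: "(\<And>v. ap f v = ap g v) \<Longrightarrow> f = g"
  by transfer auto

instantiation endo :: ring_1
begin

lift_definition zero_endo :: endo is "\<lambda>v. 0" by simp
lift_definition one_endo :: endo is "\<lambda>v. v" by simp
lift_definition plus_endo :: "endo \<Rightarrow> endo \<Rightarrow> endo" is "\<lambda>f g v. f v + g v"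
  by (simp add: scale_add_right)
lift_definition uminus_endo :: "endo \<Rightarrow> endo" is "\<lambda>f v. - f v"
  by (simp add: scale_def)
lift_definition minus_endo :: "endo \<Rightarrow> endo \<Rightarrow> endo" is "\<lambda>f g v. f v - g v"
  by (simp add: scale_def right_diff_distrib)
lift_definition times_endo :: "endo \<Rightarrow> endo \<Rightarrow> endo" is "\<lambda>f g v. f (g v)"
  by simp

instance
proof
  show "(0 :: endo) \<noteq> 1"
    by transfer (metis zero_neq_one)
qed (transfer; force simp: algebra_simps)+

end

lemma ap_0 [simp]: "ap 0 v = 0" by transfer simp
lemma ap_1 [simp]: "ap 1 v = v" by transfer simp
lemma ap_plus: "ap (f + g) v = ap f v + ap g v" by transfer simp
lemma ap_minus: "ap (f - g) v = ap f v - ap g v" by transfer simp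
lemma ap_mult: "ap (f * g) v = ap f (ap g v)" by transfer simp
lemma ap_sum_left: "ap (sum f S) v = (\<Sum>i\<in>S. ap (f i) v)"
  by (induction S rule: infinite_finite_induct) (simp_all add: ap_plus)

lift_definition scal :: "F \<Rightarrow> endo" is scale
  by (simp add: scale_add_right scale_scale mult.commute)

lemma scal_add: "scal (c + d) = scal c + scal d"
  by transfer (simp add: scale_add_left fun_eq_iff)

lemma scal_mult: "scal (c * d) = scal c * scal d"
  by transfer (simp add: scale_scale fun_eq_iff)

lemma scal_one [simp]: "scal 1 = 1"
  by transfer (simp add: fun_eq_iff)

lemma scal_zero [simp]: "scal 0 = 0"
  by transfer (simp add: scale_def fun_eq_iff)

lemma scal_minus: "scal (- c) = - scal c"
  by (metis scal_add scal_zero add.right_inverse minus_unique)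

lemma scal_of_nat: "scal (of_nat n) = of_nat n"
  by (induction n) (simp_all add: scal_add)

lemma scal_commute: "scal c * f = f * scal c"
  by transfer (simp add: fun_eq_iff)

lemma scal_left_commute: "f * (scal c * g) = scal c * (f * g)"
  by (metis mult.assoc scal_commute)

lemma ap_scal: "ap (scal c) v = scale c v"
  by transfer simp

lemma of_nat_F_neq_0 [simp]: "n \<noteq> 0 \<Longrightarrow> (of_nat n :: F) \<noteq> 0"
proof -
  have "(of_nat n :: F) = Fract (of_nat n) 1"
    by (induction n) (simp_all add: Zero_fract_def One_fract_def)
  then show "n \<noteq> 0 \<Longrightarrow> (of_nat n :: F) \<noteq> 0"
    by (simp add: Zero_fract_def eq_fract)
qed

instance endo :: torsion_free_ring_1
proof
  fix n and f :: endo
  assume *: "of_nat (Suc n) * f = 0"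
  have "f = scal (1 / of_nat (Suc n) * of_nat (Suc n)) * f"
    using of_nat_F_neq_0[of "Suc n"] by (simp del: of_nat_Suc of_nat_F_neq_0)
  also have "\<dots> = 0"
    unfolding scal_mult scal_of_nat mult.assoc * by simp
  finally show "f = 0" .
qed

text \<open>The cut-off at k \<le> n loses nothing when \<open>D $ 0 = 0\<close>, since
  \<open>D ^ k\<close> then starts in degree k; it keeps every coefficient a finite sum.\<close>

definition fexp :: "endo fps \<Rightarrow> endo fps"
  where "fexp D = Abs_fps (\<lambda>n. \<Sum>k\<le>n. scal (1 / of_nat (fact k)) * (D ^ k) $ n)"

lemma fps_power_nth_eq_0:
  fixes D :: "'a::ring_1 fps"
  assumes "D $ 0 = 0" "n < k"
  shows "(D ^ k) $ n = 0"
  using assms(2)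
proof (induction k arbitrary: n)
  case (Suc k)
  have "D $ i * (D ^ k) $ (n - i) = 0" if "i \<le> n" for i
    using Suc that assms(1) by (cases "i = 0") auto
  then show ?case
    by (simp add: fps_mult_nth)
qed simp

lemma fexp_nth_0 [simp]: "fexp D $ 0 = 1"
  by (simp add: fexp_def)

lemma fps_deriv_fexp:
  assumes D0: "D $ 0 = 0" and comm: "D * fps_deriv D = fps_deriv D * D"
  shows "fps_deriv (fexp D) = fps_deriv D * fexp D"
proof (rule fps_ext)
  fix n
  let ?s = "\<lambda>k. scal (1 / of_nat (fact k))"
  have cancel: "1 / (a * b) * a = 1 / b" if "a \<noteq> 0" for a b :: F
    using that by simp
  have s_Suc: "?s (Suc k) * of_nat (Suc k) = ?s k" for k
  proof -
    have "?s (Suc k) * of_nat (Suc k) = scal (1 / of_nat (fact (Suc k)) * of_nat (Suc k))"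
      by (simp only: scal_mult scal_of_nat)
    also have "1 / of_nat (fact (Suc k)) * of_nat (Suc k) = (1 / of_nat (fact k) :: F)"
      using cancel[OF of_nat_F_neq_0[OF Suc_not_Zero[of k]]] by (simp only: fact_Suc of_nat_mult of_nat_id)
    finally show ?thesis .
  qed
  have *: "of_nat (Suc n) * (?s (Suc k) * (D ^ Suc k) $ Suc n) =
      (\<Sum>i\<le>n. fps_deriv D $ i * (?s k * (D ^ k) $ (n - i)))" for k
  proof -
    have "of_nat (Suc n) * (?s (Suc k) * (D ^ Suc k) $ Suc n) =
        ?s (Suc k) * (fps_deriv (D ^ Suc k) $ n)"
      by (simp only: fps_deriv_nth Suc_eq_plus1 scal_left_commute)
    also have "\<dots> = ?s (Suc k) * (of_nat (Suc k) * (fps_deriv D * D ^ k) $ n)"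
      unfolding fps_deriv_power_commuting[OF comm]
      by (metis fps_mult_left_const_nth fps_of_nat)
    also have "\<dots> = ?s k * (fps_deriv D * D ^ k) $ n"
      by (simp only: s_Suc flip: mult.assoc)
    also have "\<dots> = (\<Sum>i\<le>n. fps_deriv D $ i * (?s k * (D ^ k) $ (n - i)))"
      unfolding fps_mult_nth sum_distrib_left atLeast0AtMost scal_left_commute ..
    finally show ?thesis .
  qed
  have "fps_deriv (fexp D) $ n = (\<Sum>k\<le>Suc n. of_nat (Suc n) * (?s k * (D ^ k) $ Suc n))"
    by (simp add: fexp_def sum_distrib_left del: of_nat_Suc sum.atMost_Suc)
  also have "\<dots> = (\<Sum>k\<le>n. of_nat (Suc n) * (?s (Suc k) * (D ^ Suc k) $ Suc n))"
    by (subst sum.atMost_Suc_shift) simp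
  also have "\<dots> = (\<Sum>k\<le>n. \<Sum>i\<le>n. fps_deriv D $ i * (?s k * (D ^ k) $ (n - i)))"
    by (simp only: *)
  also have "\<dots> = (\<Sum>i\<le>n. \<Sum>k\<le>n. fps_deriv D $ i * (?s k * (D ^ k) $ (n - i)))"
    by (rule sum.swap)
  \<comment> \<open>Terms with k > n - i vanish for degree reasons; what remains is the truncated
    sum defining \<open>fexp D $ (n - i)\<close>.\<close>
  also have "\<dots> = (\<Sum>i\<le>n. \<Sum>k\<le>n - i. fps_deriv D $ i * (?s k * (D ^ k) $ (n - i)))"
    by (intro sum.cong[OF refl] sum.mono_neutral_right)
       (auto simp: fps_power_nth_eq_0[OF D0])
  also have "\<dots> = (fps_deriv D * fexp D) $ n"
    by (simp add: fps_mult_nth fexp_def sum_distrib_left atLeast0AtMost)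
  finally show "fps_deriv (fexp D) $ n = (fps_deriv D * fexp D) $ n" .
qed

lemma fps_mult_commuteI:
  fixes f g :: "'a::ring_1 fps"
  assumes "\<And>i j. f $ i * g $ j = g $ j * f $ i"
  shows "f * g = g * f"
proof (rule fps_ext)
  fix n
  have "(f * g) $ n = (\<Sum>i=0..n. g $ (n - i) * f $ i)"
    by (simp add: fps_mult_nth assms)
  also have "\<dots> = (\<Sum>i=0..n. g $ i * f $ (n - i))"
    by (rule sum.reindex_bij_witness[of _ "\<lambda>i. n - i" "\<lambda>i. n - i"]) auto
  finally show "(f * g) $ n = (g * f) $ n"
    by (simp add: fps_mult_nth)
qed

text \<open>Commuting coefficients make D commute with its derivative, as the chain rule for exp
  requires; the zero constant term makes \<open>fexp D\<close> the full exponential.\<close>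

definition abelian_fps :: "'a::ring_1 fps \<Rightarrow> bool"
  where "abelian_fps D \<longleftrightarrow> D $ 0 = 0 \<and> (\<forall>i j. D $ i * D $ j = D $ j * D $ i)"

lemma abelian_fps_deriv_fexp:
  assumes "abelian_fps D"
  shows "fps_deriv (fexp D) = fps_deriv D * fexp D"
proof (rule fps_deriv_fexp)
  show "D * fps_deriv D = fps_deriv D * D"
    using assms unfolding abelian_fps_def
    by (intro fps_mult_commuteI)
       (simp del: of_nat_Suc, metis mult.assoc mult_of_nat_commute)
qed (use assms in \<open>simp add: abelian_fps_def\<close>)

text \<open>Both products solve Y' = D' Y with value x at 0, because x also commutes with the
  coefficients of D'.\<close>

lemma fexp_commute:
  assumes D: "abelian_fps D" and x: "\<And>i. x * D $ i = D $ i * x"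
  shows "x * fexp D $ n = fexp D $ n * x"
proof -
  have dx: "fps_const x * fps_deriv D = fps_deriv D * fps_const x"
    using x by (intro fps_ext) (simp del: of_nat_Suc, metis mult.assoc mult_of_nat_commute)
  have "fps_const x * fexp D = fexp D * fps_const x"
  proof (rule fps_linear_ode_unique)
    show "fps_deriv (fps_const x * fexp D) = fps_deriv D * (fps_const x * fexp D)"
      using D by (simp add: abelian_fps_deriv_fexp dx flip: mult.assoc)
    show "fps_deriv (fexp D * fps_const x) = fps_deriv D * (fexp D * fps_const x)"
      using D by (simp add: abelian_fps_deriv_fexp mult.assoc)
  qed simp
  then show ?thesis
    by (metis fps_mult_left_const_nth fps_mult_right_const_nth)
qed

text \<open>The commutator of D with x is central, and differentiating the hypothesis gives the
  commutator of D' with x, which is the derivative of the added term. So both sides solve Y' = D' Y,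
  and s \<ge> 1 makes the initial values agree.\<close>

lemma fexp_shift:
  assumes D: "abelian_fps D" and "s \<ge> 1"
    and x: "D * fps_const x = fps_const x * D + fps_const (scal c) * fps_X ^ s"
  shows "fexp D * fps_const x = (fps_const x + fps_const (scal c) * fps_X ^ s) * fexp D"
proof (rule fps_linear_ode_unique)
  let ?c = "fps_const (scal c) :: endo fps"
  have c: "?c * f = f * ?c" for f
    by (rule fps_ext) (simp add: scal_commute)
  have X: "fps_X ^ s * f = f * fps_X ^ s" for f :: "endo fps"
    by (rule fps_mult_fps_X_power_commute)
  have dx: "fps_deriv D * fps_const x = fps_const x * fps_deriv D + ?c * fps_deriv (fps_X ^ s)"
    using arg_cong[OF x, of fps_deriv] by simp
  show "fps_deriv (fexp D * fps_const x) = fps_deriv D * (fexp D * fps_const x)"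
    using D by (simp add: abelian_fps_deriv_fexp mult.assoc)
  have cX: "fps_deriv D * (?c * fps_X ^ s) = ?c * fps_X ^ s * fps_deriv D"
    by (simp only: mult.assoc[symmetric] c[symmetric, of "fps_deriv D"])
       (simp only: mult.assoc X[of "fps_deriv D"])
  have "fps_deriv D * ((fps_const x + ?c * fps_X ^ s) * fexp D) =
      (fps_deriv D * fps_const x) * fexp D + (fps_deriv D * (?c * fps_X ^ s)) * fexp D"
    by (simp only: distrib_left distrib_right mult.assoc)
  also have "\<dots> = fps_deriv ((fps_const x + ?c * fps_X ^ s) * fexp D)"
    unfolding dx cX fps_deriv_mult fps_deriv_add fps_deriv_const abelian_fps_deriv_fexp[OF D]
    by (simp add: distrib_left distrib_right mult.assoc add_ac)
  finally show "fps_deriv ((fps_const x + ?c * fps_X ^ s) * fexp D) =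
      fps_deriv D * ((fps_const x + ?c * fps_X ^ s) * fexp D)" ..
  show "(fexp D * fps_const x) $ 0 = ((fps_const x + ?c * fps_X ^ s) * fexp D) $ 0"
    using \<open>s \<ge> 1\<close> by simp
qed

section \<open>Heisenberg operators\<close>

lemma heis_deriv_scale: "heis_deriv r (Poly_Mapping.single 0 c * p) = Poly_Mapping.single 0 c * heis_deriv r p"
  by (simp add: heis_deriv_mult heis_deriv_const)

lemma heis_deriv_0 [simp]: "heis_deriv r 0 = 0"
  by (simp add: heis_deriv_def pdiff_def)

lemma lookup_single_0_mult:
  fixes v :: "int \<Rightarrow>\<^sub>0 'a::semiring_1"
  shows "Poly_Mapping.lookup (Poly_Mapping.single 0 p * v) j = p * Poly_Mapping.lookup v j"
  by (simp add: Poly_Mapping.map.rep_eq when_def flip: mult_map_scale_conv_mult)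

lemma lookup_scale: "Poly_Mapping.lookup (scale c v) j = Poly_Mapping.single 0 c * Poly_Mapping.lookup v j"
  by (simp add: scale_def lookup_single_0_mult)

lemma lookup_heis:
  "Poly_Mapping.lookup (heis k v) j =
    (if k < 0 then gen (nat (- k)) * Poly_Mapping.lookup v j
     else if k > 0 then heis_deriv (nat k) (Poly_Mapping.lookup v j) else 0)"
  by (simp add: heis_def lookup_single_0_mult Poly_Mapping.map.rep_eq when_def)

lemma heis_add: "heis k (u + v) = heis k u + heis k v"
  by (rule poly_mapping_eqI) (simp add: lookup_heis lookup_add heis_deriv_add distrib_left)

lemma heis_scale: "heis k (scale c v) = scale c (heis k v)"
  by (rule poly_mapping_eqI) (simp add: lookup_heis lookup_scale heis_deriv_scale mult.left_commute)

lift_definition cre :: "nat \<Rightarrow> endo" is "\<lambda>r. heis (- int r)"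
  by (simp add: heis_add heis_scale)

lift_definition ann :: "nat \<Rightarrow> endo" is "\<lambda>r. heis (int r)"
  by (simp add: heis_add heis_scale)

lift_definition lat :: endo is "\<lambda>v. Poly_Mapping.single 2 1 * v"
  by (simp add: distrib_left scale_mult_right)

lift_definition proj :: "int \<Rightarrow> endo" is "\<lambda>n v. Poly_Mapping.single n (Poly_Mapping.lookup v n)"
  by (auto simp: lookup_add single_add scale_def mult_single lookup_single_0_mult)

definition heis_norm :: "nat \<Rightarrow> F"
  where "heis_norm r = qint (2 * int r) * qint (int r) / of_nat r"

lemma ann_cre:
  assumes "r \<ge> 1" "s \<ge> 1"
  shows "ann r * cre s = cre s * ann r + (if r = s then scal (heis_norm r) else 0)"
proof (rule endo_eqI)
  fix v
  show "ap (ann r * cre s) v = ap (cre s * ann r + (if r = s then scal (heis_norm r) else 0)) v"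
    using assms
    by (intro poly_mapping_eqI)
       (auto simp: ap_mult ap_plus cre.rep_eq ann.rep_eq lookup_heis heis_deriv_mult
         heis_deriv_gen heis_norm_def lookup_add ap_scal lookup_scale)
qed

lemma cre_cre: "cre r * cre s = cre s * cre r"
  by (intro endo_eqI poly_mapping_eqI) (simp add: ap_mult cre.rep_eq lookup_heis mult.left_commute)

lemma pdiff_commute: "pdiff i (pdiff j p) = pdiff j (pdiff i p)"
proof (induction p rule: single_sum_induct)
  case (single m c)
  have "m - Poly_Mapping.single j 1 - Poly_Mapping.single i 1 =
      m - Poly_Mapping.single i 1 - Poly_Mapping.single j (1::nat)"
    by (rule poly_mapping_eqI) (simp add: lookup_minus)
  then show ?case
    by (cases "i = j") (simp_all add: pdiff_single lookup_minus lookup_single mult.left_commute)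
qed (simp_all add: pdiff_add, simp add: pdiff_def)

lemma pdiff_scale: "pdiff i (Poly_Mapping.single 0 c * p) = Poly_Mapping.single 0 c * pdiff i p"
  by (simp add: pdiff_mult pdiff_single)

lemma pdiff_0 [simp]: "pdiff i 0 = 0"
  by (simp add: pdiff_def)

lemma ann_ann: "ann r * ann s = ann s * ann r"
  by (intro endo_eqI poly_mapping_eqI)
     (simp add: ap_mult ann.rep_eq lookup_heis heis_deriv_def pdiff_scale
       pdiff_commute[of "r - Suc 0"] mult.left_commute)

lemma heis_0 [simp]: "heis k 0 = 0"
  by (simp add: poly_mapping_eqI lookup_heis)

lemma lat_heis: "Poly_Mapping.single 2 1 * heis k v = heis k (Poly_Mapping.single 2 1 * v)"
proof (induction v rule: single_sum_induct)
  case zero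
  show ?case by simp
next
  case (single m c)
  show ?case by (simp add: heis_def mult_single)
next
  case (add v w)
  then show ?case by (simp add: heis_add distrib_left)
qed

lemma lat_cre: "lat * cre r = cre r * lat"
  by (rule endo_eqI) (simp add: ap_mult lat.rep_eq cre.rep_eq lat_heis)

lemma lat_ann: "lat * ann r = ann r * lat"
  by (rule endo_eqI) (simp add: ap_mult lat.rep_eq ann.rep_eq lat_heis)

lemma proj_cre: "proj n * cre r = cre r * proj n"
  by (intro endo_eqI poly_mapping_eqI)
     (simp add: ap_mult proj.rep_eq cre.rep_eq lookup_heis lookup_single when_def)

lemma proj_ann: "proj n * ann r = ann r * proj n"
  by (intro endo_eqI poly_mapping_eqI)
     (simp add: ap_mult proj.rep_eq ann.rep_eq lookup_heis lookup_single when_def)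

section \<open>Generating series and their translation rule\<close>

definition cre_fps :: "(nat \<Rightarrow> F) \<Rightarrow> endo fps"
  where "cre_fps c = Abs_fps (\<lambda>r. if r = 0 then 0 else scal (c r) * cre r)"

definition ann_fps :: "(nat \<Rightarrow> F) \<Rightarrow> endo fps"
  where "ann_fps c = Abs_fps (\<lambda>r. if r = 0 then 0 else scal (c r) * ann r)"

lemma scal_mult_commute:
  assumes "x * y = y * x"
  shows "(scal c * x) * (scal d * y) = (scal d * y) * (scal c * x)"
proof -
  have 1: "(scal a * u) * (scal b * w) = scal (a * b) * (u * w)" for a b u w
    by (simp add: scal_mult mult.assoc scal_left_commute[of u])
  show ?thesis
    unfolding 1 assms by (simp add: mult.commute)
qed

lemma commute_scal_mult:
  assumes "x * y = y * x"
  shows "x * (scal d * y) = (scal d * y) * x"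
  using scal_mult_commute[of x y 1 d] assms by simp

lemma abelian_cre_fps: "abelian_fps (cre_fps c)"
  unfolding abelian_fps_def cre_fps_def
  using scal_mult_commute[OF cre_cre] by simp

lemma abelian_ann_fps: "abelian_fps (ann_fps c)"
  unfolding abelian_fps_def ann_fps_def
  using scal_mult_commute[OF ann_ann] by simp

lemma commute_fexp_cre:
  assumes "\<And>r. x * cre r = cre r * x"
  shows "x * fexp (cre_fps c) $ n = fexp (cre_fps c) $ n * x"
  using assms by (intro fexp_commute abelian_cre_fps) (simp add: cre_fps_def commute_scal_mult)

lemma commute_fexp_ann:
  assumes "\<And>r. x * ann r = ann r * x"
  shows "x * fexp (ann_fps c) $ n = fexp (ann_fps c) $ n * x"
  using assms by (intro fexp_commute abelian_ann_fps) (simp add: ann_fps_def commute_scal_mult)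

lemma fexp_cre_cre: "fexp (cre_fps c) $ m * fexp (cre_fps d) $ n = fexp (cre_fps d) $ n * fexp (cre_fps c) $ m"
  by (intro commute_fexp_cre commute_fexp_cre[symmetric] cre_cre)

lemma fexp_ann_ann: "fexp (ann_fps c) $ m * fexp (ann_fps d) $ n = fexp (ann_fps d) $ n * fexp (ann_fps c) $ m"
  by (intro commute_fexp_ann commute_fexp_ann[symmetric] ann_ann)

text \<open>Moving B(w) past a(-s) shifts this generator by a scalar multiple of w^s. Such shifts
  add up under products, so the two annihilation exponentials of a current can be treated as one
  series.\<close>

definition translates :: "endo fps \<Rightarrow> (nat \<Rightarrow> F) \<Rightarrow> bool"
  where "translates B g \<longleftrightarrow> (\<forall>s\<ge>1. B * fps_const (cre s) =
    (fps_const (cre s) + fps_const (scal (g s)) * fps_X ^ s) * B)"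

text \<open>Only the term r = s of the annihilation sum fails to commute with a(-s), and its
  commutator is a scalar, so \<open>fexp_shift\<close> applies.\<close>

lemma translates_fexp_ann: "translates (fexp (ann_fps c)) (\<lambda>s. c s * heis_norm s)"
  unfolding translates_def
proof (intro allI impI fexp_shift abelian_ann_fps)
  fix s :: nat assume s: "s \<ge> 1"
  show "ann_fps c * fps_const (cre s) =
      fps_const (cre s) * ann_fps c + fps_const (scal (c s * heis_norm s)) * fps_X ^ s"
  proof (rule fps_ext)
    fix n
    have "(scal (c n) * ann n) * cre s =
        cre s * (scal (c n) * ann n) + (if n = s then scal (c s * heis_norm s) else 0)" if "n \<ge> 1"
      by (simp add: mult.assoc ann_cre[OF that s] distrib_left scal_left_commute[of "cre s"] scal_mult)
    then show "(ann_fps c * fps_const (cre s)) $ n =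
        (fps_const (cre s) * ann_fps c + fps_const (scal (c s * heis_norm s)) * fps_X ^ s) $ n"
      using s by (auto simp: ann_fps_def fps_X_power_nth)
  qed
qed

lemma translates_mult:
  assumes "translates A f" "translates B g"
  shows "translates (A * B) (\<lambda>s. f s + g s)"
  unfolding translates_def
proof (intro allI impI)
  fix s :: nat assume s: "s \<ge> 1"
  let ?f = "fps_const (scal (f s)) :: endo fps" and ?g = "fps_const (scal (g s)) :: endo fps"
  let ?a = "fps_const (cre s)" and ?X = "fps_X ^ s :: endo fps"
  have gX: "A * (?g * ?X) = (?g * ?X) * A"
  proof -
    have "A * ?g = ?g * A"
      by (rule fps_ext) (simp add: scal_commute)
    then show ?thesis
      by (simp only: fps_mult_fps_X_power_commute[of s A] mult.assoc flip: mult.assoc[of A ?g])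
  qed
  have "A * B * ?a = A * (?a + ?g * ?X) * B"
    using assms(2) s by (simp add: translates_def mult.assoc)
  also have "A * (?a + ?g * ?X) = A * ?a + (?g * ?X) * A"
    unfolding distrib_left gX ..
  also have "\<dots> = (?a + ?f * ?X + ?g * ?X) * A"
    using assms(1) s by (simp add: translates_def distrib_right)
  also have "?a + ?f * ?X + ?g * ?X = ?a + fps_const (scal (f s + g s)) * ?X"
    by (simp add: scal_add distrib_right add.assoc flip: fps_const_add)
  finally show "A * B * ?a = (?a + fps_const (scal (f s + g s)) * ?X) * (A * B)"
    by (simp add: mult.assoc)
qed

lemma fexp_vacuum:
  assumes "\<And>i. ap (D $ i) v = 0" "n > 0"
  shows "ap (fexp D $ n) v = 0"
proof -
  have "ap ((D ^ k) $ n) v = 0" for k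
  proof (cases k)
    case (Suc l)
    show ?thesis
      unfolding Suc power_Suc2 by (simp add: fps_mult_nth ap_sum_left ap_mult assms(1))
  qed (use assms(2) in simp)
  then show ?thesis
    by (simp add: fexp_def ap_sum_left ap_mult)
qed

definition locally_finite :: "endo fps \<Rightarrow> bool"
  where "locally_finite f \<longleftrightarrow> (\<forall>v. finite {n. ap (f $ n) v \<noteq> 0})"

text \<open>Every vector is a sum of products of creation operators applied to multiples of some
  e^\<mu>, on which only the coefficient of index 0 survives. By the translation rule, a(-s)
  enlarges a set S of surviving indices at most to the union of S and s + S.\<close>

lemma locally_finite_fexp_ann: "locally_finite (fexp (ann_fps c))"
proof -
  let ?f = "fexp (ann_fps c)"
  define N where "N v \<longleftrightarrow> finite {n. ap (?f $ n) v \<noteq> 0}" for v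
  have N_add: "N (u + v)" if "N u" "N v" for u v
  proof -
    have "{n. ap (?f $ n) (u + v) \<noteq> 0} \<subseteq> {n. ap (?f $ n) u \<noteq> 0} \<union> {n. ap (?f $ n) v \<noteq> 0}"
      by auto
    then show ?thesis
      using that unfolding N_def by (meson finite_UnI finite_subset)
  qed
  have N_cre: "N (ap (cre s) v)" if v: "N v" and s: "s \<ge> 1" for s v
  proof -
    let ?S = "{n. ap (?f $ n) v \<noteq> 0}" and ?x = "scal (c s * heis_norm s)"
    have "?f $ n * cre s = cre s * ?f $ n + (if n < s then 0 else ?x * ?f $ (n - s))" for n
    proof -
      have "?f * fps_const (cre s) = fps_const (cre s) * ?f + fps_const ?x * (fps_X ^ s * ?f)"
        using translates_fexp_ann[of c] s by (simp add: translates_def distrib_right mult.assoc)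
      from arg_cong[OF this, of "\<lambda>h. h $ n"] show ?thesis
        by (simp add: fps_X_power_mult_nth)
    qed
    then have eq: "ap (?f $ n) (ap (cre s) v) =
        ap (cre s) (ap (?f $ n) v) + (if n < s then 0 else ap ?x (ap (?f $ (n - s)) v))" for n
      by (simp add: ap_plus ap_mult flip: ap_mult[of "?f $ n"])
    have "n \<in> ?S \<union> (+) s ` ?S" if "ap (?f $ n) (ap (cre s) v) \<noteq> 0" for n
    proof (cases "n \<in> ?S")
      case False
      with that eq[of n] have "\<not> n < s" "n - s \<in> ?S"
        by (auto split: if_splits)
      then show ?thesis
        by (intro UnI2 image_eqI[of _ _ "n - s"]) auto
    qed simp
    then have "{n. ap (?f $ n) (ap (cre s) v) \<noteq> 0} \<subseteq> ?S \<union> (+) s ` ?S"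
      by blast
    then show ?thesis
      using v unfolding N_def by (meson finite_UnI finite_imageI finite_subset)
  qed
  have N_monom: "N (Poly_Mapping.single 0 (Poly_Mapping.single m 1) * v)" if "N v" for m v
    using that
  proof (induction m arbitrary: v rule: single_sum_induct)
    case zero
    then show ?case by simp
  next
    case (single i e)
    then show ?case
    proof (induction e)
      case (Suc e)
      have "Poly_Mapping.single i (Suc e) = Poly_Mapping.single i 1 + Poly_Mapping.single i e"
        by (simp flip: single_add)
      then have "Poly_Mapping.single 0 (Poly_Mapping.single (Poly_Mapping.single i (Suc e)) 1) * v =
          Poly_Mapping.single 0 (Poly_Mapping.single (Poly_Mapping.single i 1) 1) *
            (Poly_Mapping.single 0 (Poly_Mapping.single (Poly_Mapping.single i e) (1::F)) * v)"
        by (simp add: mult_single flip: mult.assoc)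
      \<comment> \<open>The variable with index i is the generator a(-(i + 1)), hence
        \<open>Suc i\<close>.\<close>
      also have "\<dots> = ap (cre (Suc i))
            (Poly_Mapping.single 0 (Poly_Mapping.single (Poly_Mapping.single i e) 1) * v)"
        by (simp add: cre.rep_eq heis_def gen_def nat_add_distrib)
      finally show ?case
        using N_cre Suc by simp
    qed simp
  next
    case (add m m')
    have "Poly_Mapping.single 0 (Poly_Mapping.single (m + m') 1) * v =
        Poly_Mapping.single 0 (Poly_Mapping.single m 1) *
          (Poly_Mapping.single 0 (Poly_Mapping.single m' (1::F)) * v)"
      by (simp add: mult_single flip: mult.assoc)
    then show ?case
      by (simp only: add)
  qed
  have N_vac: "N (Poly_Mapping.single k (Poly_Mapping.single 0 d))" for k d
  proof -
    have "ap (ann_fps c $ i) (Poly_Mapping.single k (Poly_Mapping.single 0 d)) = 0" for i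
      by (simp add: ann_fps_def ap_mult ann.rep_eq heis_def heis_deriv_const)
    from fexp_vacuum[OF this]
    have "{n. ap (?f $ n) (Poly_Mapping.single k (Poly_Mapping.single 0 d)) \<noteq> 0} \<subseteq> {0}"
      by auto
    then show ?thesis
      unfolding N_def by (rule finite_subset) simp
  qed
  have N_0: "N 0"
    by (simp add: N_def)
  have "N (Poly_Mapping.single k p)" for k p
  proof (induction p rule: single_sum_induct)
    case (single m d)
    show ?case
      using N_monom[OF N_vac[of k d], of m] by (simp add: mult_single)
  qed (simp_all add: N_0 single_add N_add)
  then have "N v" for v
    by (induction v rule: single_sum_induct) (simp_all add: N_0 N_add)
  then show ?thesis
    by (simp add: locally_finite_def N_def)
qed

section \<open>Commuting annihilation past creation\<close>

text \<open>Two variables are nested: z is the outer one, w the inner one.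
  \<open>const_coeffs f\<close> is f(z) and \<open>fps_const B\<close> is B(w), so that operators in
  different variables multiply in the order written.\<close>

definition const_coeffs :: "'a::ring_1 fps \<Rightarrow> 'a fps fps"
  where "const_coeffs f = Abs_fps (\<lambda>n. fps_const (f $ n))"

lemma const_coeffs_mult: "const_coeffs (f * g) = const_coeffs f * const_coeffs g"
proof (rule fps_ext)
  fix n
  have sum: "fps_const (sum h S) = (\<Sum>i\<in>S. fps_const (h i))" for h :: "nat \<Rightarrow> 'a" and S
    by (induction S rule: infinite_finite_induct) (simp_all flip: fps_const_add)
  show "const_coeffs (f * g) $ n = (const_coeffs f * const_coeffs g) $ n"
    by (simp add: const_coeffs_def fps_mult_nth sum)
qed

lemma fps_deriv_const_coeffs: "fps_deriv (const_coeffs f) = const_coeffs (fps_deriv f)"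
  by (rule fps_ext) (simp add: const_coeffs_def fps_of_nat[symmetric] del: of_nat_Suc fps_const_add)

text \<open>As series in z, both sides solve Y' = (P' + \<gamma>) Y, where \<gamma> = -2w/(1 - zw)
  is the logarithmic derivative of (1 - zw)^2. On the left, \<gamma> comes from moving B(w) past
  P'(z): the generator a(-n) contributes n b_n g_n w^n z^(n-1) = -2 w^n z^(n-1).\<close>

lemma vertex_commutation:
  assumes B: "translates B g" and bg: "\<And>n. n \<ge> 1 \<Longrightarrow> b n * g n = - 2 / of_nat n"
  shows "fps_const B * const_coeffs (fexp (cre_fps b)) =
    (1 - fps_const fps_X * fps_X)\<^sup>2 * (const_coeffs (fexp (cre_fps b)) * fps_const B)"
proof (rule fps_linear_ode_unique)
  let ?P = "cre_fps b" and ?B = "fps_const B"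
  let ?C = "const_coeffs (fexp ?P)" and ?P' = "const_coeffs (fps_deriv ?P)"
  let ?t = "fps_const fps_X * fps_X :: endo fps fps" and ?w = "fps_const fps_X :: endo fps fps"
  \<comment> \<open>The geometric series w/(1 - zw), expanded in z.\<close>
  define \<Gamma> :: "endo fps fps" where "\<Gamma> = Abs_fps (\<lambda>n. fps_X ^ Suc n)"
  define \<gamma> where "\<gamma> = - (\<Gamma> + \<Gamma>)"
  have w: "f * ?w = ?w * f" for f :: "endo fps fps"
    by (rule fps_ext) (simp add: fps_mult_fps_X_commute)
  have t: "f * ?t = ?t * f" for f :: "endo fps fps"
  proof -
    have "f * ?t = (f * ?w) * fps_X"
      by (simp only: mult.assoc)
    also have "\<dots> = ?w * (f * fps_X)"
      by (simp only: w[of f] mult.assoc)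
    finally show ?thesis
      by (simp only: fps_mult_fps_X_commute[of f] mult.assoc)
  qed
  have G: "f * (1 - ?t)\<^sup>2 = (1 - ?t)\<^sup>2 * f" for f :: "endo fps fps"
  proof -
    have "f * (1 - ?t) = (1 - ?t) * f"
      by (simp only: left_diff_distrib right_diff_distrib t[of f] mult_1_left mult_1_right)
    note comm = this
    show ?thesis
      unfolding power2_eq_square
      by (simp only: mult.assoc[symmetric] comm) (simp only: mult.assoc comm)
  qed
  have C': "fps_deriv ?C = ?P' * ?C"
    by (simp add: fps_deriv_const_coeffs abelian_fps_deriv_fexp[OF abelian_cre_fps] const_coeffs_mult)
  have BP': "?B * ?P' = (?P' + \<gamma>) * ?B"
  proof (rule fps_ext)
    fix n
    let ?k = "Suc n"
    define s where "s = of_nat ?k * b ?k"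
    let ?s = "fps_const (scal s) :: endo fps" and ?a = "fps_const (cre ?k)" and ?X = "fps_X ^ ?k :: endo fps"
    have "s * g ?k = of_nat ?k * (- 2 / of_nat ?k)"
      using bg[of ?k] by (simp add: s_def mult.assoc del: of_nat_Suc)
    also have "\<dots> = - 2"
      by (rule nonzero_mult_div_cancel_left[of "of_nat ?k :: F" "- 2", simplified times_divide_eq_right[symmetric]])
         (rule of_nat_F_neq_0, simp)
    finally have sg: "s * g ?k = - (1 + 1)"
      by simp
    have P'n: "?P' $ n = ?s * ?a"
      by (simp add: const_coeffs_def cre_fps_def s_def scal_mult scal_of_nat mult.assoc del: of_nat_Suc)
    have sB: "B * ?s = ?s * B"
      by (rule fps_ext) (simp add: scal_commute)
    have "(?B * ?P') $ n = B * ?s * ?a"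
      by (simp only: fps_mult_left_const_nth P'n mult.assoc)
    also have "\<dots> = ?s * (B * ?a)"
      by (simp only: sB mult.assoc)
    also have "B * ?a = (?a + fps_const (scal (g ?k)) * ?X) * B"
      using B by (simp add: translates_def)
    also have "?s * \<dots> = (?s * ?a + (?s * fps_const (scal (g ?k))) * ?X) * B"
      by (simp only: distrib_left distrib_right mult.assoc)
    also have "?s * fps_const (scal (g ?k)) = - (1 + 1)"
      unfolding fps_const_mult scal_mult[symmetric] sg scal_minus scal_add scal_one
      by (simp only: fps_const_neg[symmetric] fps_const_add[symmetric] fps_const_1_eq_1)
    also have "(?s * ?a + - (1 + 1) * ?X) * B = ((?P' + \<gamma>) * ?B) $ n"
      by (simp add: P'n \<gamma>_def \<Gamma>_def algebra_simps mult_2)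
    finally show "(?B * ?P') $ n = ((?P' + \<gamma>) * ?B) $ n" .
  qed
  show "fps_deriv (?B * ?C) = (?P' + \<gamma>) * (?B * ?C)"
    by (simp add: C' BP' flip: mult.assoc)
  have "\<Gamma> * (1 - ?t) = ?w"
  proof (rule fps_ext)
    fix n
    show "(\<Gamma> * (1 - ?t)) $ n = ?w $ n"
      by (cases n) (simp_all add: \<Gamma>_def right_diff_distrib flip: mult.assoc,
          simp add: mult.assoc power_commutes)
  qed
  then have \<Gamma>G: "\<Gamma> * (1 - ?t)\<^sup>2 = ?w * (1 - ?t)"
    unfolding power2_eq_square by (simp flip: mult.assoc)
  have dt: "fps_deriv (1 - ?t) = - ?w"
    by simp
  have "fps_deriv ((1 - ?t)\<^sup>2) = - ((1 - ?t) * ?w + ?w * (1 - ?t))"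
    unfolding power2_eq_square fps_deriv_mult dt
    by (simp only: mult_minus_left mult_minus_right minus_add_distrib)
  also have "\<dots> = \<gamma> * (1 - ?t)\<^sup>2"
    by (simp only: w[of "1 - ?t"] \<gamma>_def mult_minus_left distrib_right \<Gamma>G)
  finally have G': "fps_deriv ((1 - ?t)\<^sup>2) = \<gamma> * (1 - ?t)\<^sup>2" .
  have "fps_deriv ((1 - ?t)\<^sup>2 * (?C * ?B)) = (1 - ?t)\<^sup>2 * ?P' * (?C * ?B) + \<gamma> * (1 - ?t)\<^sup>2 * (?C * ?B)"
    by (simp add: C' G' mult.assoc)
  also have "\<dots> = (?P' + \<gamma>) * ((1 - ?t)\<^sup>2 * (?C * ?B))"
    by (simp only: G[symmetric] distrib_right mult.assoc)
  finally show "fps_deriv ((1 - ?t)\<^sup>2 * (?C * ?B)) = (?P' + \<gamma>) * ((1 - ?t)\<^sup>2 * (?C * ?B))" .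
  show "(?B * ?C) $ 0 = ((1 - ?t)\<^sup>2 * (?C * ?B)) $ 0"
    by (simp add: const_coeffs_def power2_eq_square)
qed

section \<open>The contraction coefficient as an identity in F\<close>

lemma qhalf_power: "qhalf ^ n = Fract (monom 1 n) 1"
  by (induction n) (simp_all add: qhalf_def One_fract_def monom_0 monom_Suc one_pCons)

lemma qhalf_neq_0 [simp]: "qhalf \<noteq> 0"
  by (simp add: qhalf_def Zero_fract_def eq_fract)

text \<open>Degrees of polynomials show that q^(1/2) is transcendental over the constants. The
  exponents 4r and 4 then keep q^(2r) - 1, 1 + q^(2r) and q - 1/q from vanishing.\<close>

lemma qhalf_power_neq_const:
  assumes "n > 0"
  shows "qhalf ^ n \<noteq> Fract [:c:] 1"
proof
  assume "qhalf ^ n = Fract [:c:] 1"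
  then have "monom 1 n = [:c:]"
    by (simp add: qhalf_power eq_fract)
  then have "degree (monom (1::complex) n) = degree [:c:]"
    by simp
  then show False
    using assms by (simp add: degree_monom_eq)
qed

lemma contraction_coefficient:
  assumes "r \<ge> 1"
  shows "qhalf powi (- int r) / qint (int r) *
    (- (qhalf powi (- int r) / qint (int r)) * heis_norm r +
     (q - inverse q) * (- (qhalf ^ r) / (1 + q ^ (2 * r))) * heis_norm r) = - 2 / of_nat r"
proof -
  define u where "u = q ^ r"
  define h where "h = qhalf ^ r"
  have hu: "u = h ^ 2"
    by (simp add: u_def h_def q_def flip: power_mult) (simp add: mult.commute)
  have h0: "h \<noteq> 0"
    by (simp add: h_def)
  have u0: "u \<noteq> 0"
    by (simp add: hu h0)
  have ne1: "u ^ 2 - 1 \<noteq> 0"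
    using qhalf_power_neq_const[of "4 * r" 1] assms
    by (simp add: u_def q_def One_fract_def one_pCons flip: power_mult)
  have ne2: "1 + u ^ 2 \<noteq> 0"
  proof
    assume "1 + u ^ 2 = 0"
    then have "u ^ 2 = Fract [:-1:] 1"
      by (simp add: add_eq_0_iff One_fract_def one_pCons)
    moreover have "u ^ 2 = qhalf ^ (4 * r)"
      by (simp add: u_def q_def mult_ac flip: power_mult)
    ultimately show False
      using qhalf_power_neq_const[of "4 * r" "-1"] assms by simp
  qed
  define \<delta> where "\<delta> = q - inverse q"
  have \<delta>: "\<delta> \<noteq> 0"
  proof
    assume "\<delta> = 0"
    then have "q ^ 2 = 1"
      by (simp add: \<delta>_def power2_eq_square field_simps q_def)
    then have "qhalf ^ 4 = Fract [:1:] 1"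
      by (simp add: q_def One_fract_def one_pCons flip: power_mult)
    then show False
      using qhalf_power_neq_const[of 4 1] by simp
  qed
  have qint1: "qint (int r) = (u - inverse u) / \<delta>"
    by (simp add: qint_def u_def \<delta>_def power_int_minus)
  have "int r * 2 = int (2 * r)"
    by simp
  then have qint2: "qint (2 * int r) = (u ^ 2 - inverse (u ^ 2)) / \<delta>"
    unfolding mult.commute[of 2] qint_def
    by (simp only: power_int_minus power_int_of_nat u_def \<delta>_def) (simp add: mult.commute flip: power_mult)
  have hp: "qhalf powi (- int r) = inverse h"
    by (simp add: h_def power_int_minus)
  have q2: "q ^ (2 * r) = u ^ 2"
    by (simp add: u_def mult.commute flip: power_mult)
  have r0: "(of_nat r :: F) \<noteq> 0"
    using assms by simp
  have e1: "u - inverse u = (u ^ 2 - 1) / u"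
    using u0 by (simp add: field_simps power2_eq_square)
  have e2: "u ^ 2 - inverse (u ^ 2) = (u ^ 2 - 1) * (1 + u ^ 2) / u ^ 2"
    using u0 by (simp add: field_simps power2_eq_square)
  \<comment> \<open>Here p stands for u^2 - 1, y for 1 + u^2 and n for r. The quantum integers
    cancel down to y + p, which is 2 u^2, so u disappears after division by u^2.\<close>
  have cancel: "inverse h / (p / u / \<delta>) *
      (- (inverse h / (p / u / \<delta>)) * (p * y / u ^ 2 / \<delta> * (p / u / \<delta>) / n) +
       \<delta> * (- h / y) * (p * y / u ^ 2 / \<delta> * (p / u / \<delta>) / n)) = - ((y + p) / u ^ 2 / n)"
    if "p \<noteq> 0" "y \<noteq> 0" "n \<noteq> 0" for p y n :: F
  proof -
    \<comment> \<open>Q and W play the roles of [r] and [2r], so that W Q / n is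
      \<open>heis_norm r\<close>.\<close>
    have "inverse h / Q * (- (inverse h / Q) * (W * Q / n) + \<delta> * (- h / y) * (W * Q / n)) =
        - (W / Q / h ^ 2 / n) - \<delta> * W / y / n" if "Q \<noteq> 0" for Q W
    proof -
      have "inverse h / Q * (- (inverse h / Q) * (W * Q / n)) = - (W / Q / h ^ 2 / n)"
        using that h0 by (simp add: divide_inverse power2_eq_square mult_ac)
      moreover have "inverse h / Q * (\<delta> * (- h / y) * (W * Q / n)) = - (\<delta> * W / y / n)"
        using that h0 by (simp add: field_simps)
      ultimately show ?thesis
        by (simp only: distrib_left) simp
    qed
    from this[of "p / u / \<delta>" "p * y / u ^ 2 / \<delta>", unfolded hu[symmetric]] that \<delta> u0
    show ?thesis
      by (simp add: add_divide_distrib power2_eq_square)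
  qed
  show ?thesis
    unfolding heis_norm_def qint1 qint2 hp q2 h_def[symmetric] \<delta>_def[symmetric] e1 e2
    using cancel[OF ne1 ne2 r0] u0 by simp
qed

section \<open>Series of operators\<close>

text \<open>With the value 0 at negative indices, the index shifts by 1 and 2 in the commutation
  relation need no case distinction.\<close>

definition coeff_at :: "endo fps \<Rightarrow> int \<Rightarrow> endo"
  where "coeff_at f n = (if n < 0 then 0 else f $ nat n)"

text \<open>The power series is read in the variable \<open>z\<close> for \<open>s = 1\<close> and in \<open>1/z\<close> for \<open>s = -1\<close>.\<close>

definition emb :: "int \<Rightarrow> endo fps \<Rightarrow> int series"
  where "emb s f = (\<lambda>n v. ap (coeff_at f (s * n)) v)"

lemma ap_Sum_any:
  assumes "finite {i. g i \<noteq> 0}"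
  shows "ap f (Sum_any g) = Sum_any (\<lambda>i. ap f (g i))"
proof -
  have "Sum_any (\<lambda>i. ap f (g i)) = (\<Sum>i | g i \<noteq> 0. ap f (g i))"
    using assms by (intro Sum_any.expand_superset) auto
  then show ?thesis
    by (simp add: Sum_any.expand_set ap_sum)
qed

text \<open>Outside 0..m one of the two factors is 0, so the sum over all integers is a finite
  Cauchy product.\<close>

lemma coeff_at_mult:
  "Sum_any (\<lambda>i. ap (coeff_at f i) (ap (coeff_at g (m - i)) v)) = ap (coeff_at (f * g) m) v"
proof -
  let ?h = "\<lambda>i. ap (coeff_at f i) (ap (coeff_at g (m - i)) v)"
  have supp: "{i. ?h i \<noteq> 0} \<subseteq> {0..m}"
    by (auto simp: coeff_at_def split: if_splits)
  show ?thesis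
  proof (cases "m < 0")
    case True
    then show ?thesis
      using supp by (simp add: coeff_at_def)
  next
    case False
    have "Sum_any ?h = (\<Sum>i\<in>{0..m}. ?h i)"
      by (rule Sum_any.expand_superset) (use supp in auto)
    also have "\<dots> = (\<Sum>i=0..nat m. ap (f $ i) (ap (g $ (nat m - i)) v))"
      using False by (intro sum.reindex_bij_witness[of _ int nat])
        (auto simp: coeff_at_def nat_diff_distrib nat_le_iff)
    also have "\<dots> = ap (coeff_at (f * g) m) v"
      using False by (simp add: coeff_at_def fps_mult_nth ap_sum_left ap_mult)
    finally show ?thesis .
  qed
qed

lemma sign_bij: "s = 1 \<or> s = - 1 \<Longrightarrow> bij (\<lambda>i::int. s * i)"
  by (rule o_bij[of "\<lambda>i. s * i"]) (auto simp: fun_eq_iff)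

lemma emb_mult:
  assumes "s = 1 \<or> s = - 1"
  shows "emb s f \<star> emb s g = emb s (f * g)"
proof (intro ext)
  fix n v
  have "(emb s f \<star> emb s g) n v =
      Sum_any (\<lambda>i. ap (coeff_at f i) (ap (coeff_at g (s * n - i)) v))"
    unfolding smul_def
    by (rule Sum_any.reindex_cong[OF sign_bij[OF assms], symmetric])
       (simp add: emb_def fun_eq_iff right_diff_distrib)
  then show "(emb s f \<star> emb s g) n v = emb s (f * g) n v"
    by (simp add: coeff_at_mult emb_def)
qed

lemma sone_eq_emb:
  assumes "s = 1 \<or> s = - 1"
  shows "sone = emb s 1"
  using assms by (auto simp: fun_eq_iff sone_def emb_def coeff_at_def)

lemma spow_emb:
  assumes "s = 1 \<or> s = - 1"
  shows "spow (emb s f) k = emb s (f ^ k)"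
proof (induction k)
  case 0
  show ?case
    by (simp add: spow_def sprod_def sone_eq_emb[OF assms])
next
  case (Suc k)
  have "spow (emb s f) (Suc k) = emb s f \<star> spow (emb s f) k"
    by (simp add: spow_def sprod_def)
  then show ?case
    by (simp add: Suc emb_mult[OF assms])
qed

lemma sexp_emb:
  assumes "s = 1 \<or> s = - 1" "D $ 0 = 0"
  shows "sexp (emb s D) = emb s (fexp D)"
proof (intro ext)
  fix n v
  let ?h = "\<lambda>k. scale (1 / of_nat (fact k)) (ap (coeff_at (D ^ k) (s * n)) v)"
  have "sexp (emb s D) n v = Sum_any ?h"
    by (simp add: sexp_def spow_emb[OF assms(1)]) (simp add: emb_def)
  \<comment> \<open>Powers beyond the degree vanish, which turns the unbounded sum into the
    truncated one of \<open>fexp\<close>.\<close>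
  also have "\<dots> = (\<Sum>k\<le>nat (s * n). ?h k)"
    using fps_power_nth_eq_0[OF assms(2)]
    by (intro Sum_any.expand_superset) (auto simp: coeff_at_def intro: leI)
  also have "\<dots> = emb s (fexp D) n v"
    by (simp add: emb_def coeff_at_def fexp_def ap_sum_left ap_mult ap_scal)
  finally show "sexp (emb s D) n v = emb s (fexp D) n v" .
qed

lemma factor_series_Creation: "factor_series (Creation c) = emb 1 (fexp (cre_fps c))"
proof -
  have "(\<lambda>n v. if n \<ge> 1 then scale (c (nat n)) (heis (- n) v) else 0) = emb 1 (cre_fps c)"
    by (auto simp: fun_eq_iff emb_def coeff_at_def cre_fps_def ap_mult ap_scal cre.rep_eq)
  then show ?thesis
    by (simp add: sexp_emb cre_fps_def)
qed

lemma factor_series_Annihilation: "factor_series (Annihilation c) = emb (- 1) (fexp (ann_fps c))"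
proof -
  have "(\<lambda>n v. if n \<le> - 1 then scale (c (nat (- n))) (heis (- n) v) else 0) = emb (- 1) (ann_fps c)"
    by (auto simp: fun_eq_iff emb_def coeff_at_def ann_fps_def ap_mult ap_scal ann.rep_eq)
  then show ?thesis
    by (simp add: sexp_emb ann_fps_def)
qed

lemma factor_series_Lattice: "factor_series Lattice = (\<lambda>n v. if n = 0 then ap lat v else 0)"
  by (simp add: lat.rep_eq fun_eq_iff)

lemma factor_series_Grading: "factor_series Grading = (\<lambda>n v. ap (proj n) v)"
  by (simp add: proj.rep_eq)

section \<open>Additivity and finiteness of operator series\<close>

definition additive_series :: "'e series \<Rightarrow> bool"
  where "additive_series X \<longleftrightarrow> (\<forall>n u v. X n (u + v) = X n u + X n v)"

text \<open>Annihilation, lattice and grading factors have this property. Creation factors can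
  produce arbitrarily high powers of z on one vector, so they are kept at the left end of
  products.\<close>

definition finite_series :: "'e series \<Rightarrow> bool"
  where "finite_series X \<longleftrightarrow> (\<forall>v. finite {n. X n v \<noteq> 0})"

lemma additive_series_0: "additive_series X \<Longrightarrow> X n 0 = 0"
  unfolding additive_series_def by (metis add_cancel_right_right add_0)

text \<open>\<open>Sum_any\<close> is additive only on finite supports. The support is an assumption
  here because the two creation factors of the normally ordered product call for a finiteness
  argument of their own.\<close>

lemma additive_smul:
  fixes A B :: "('e::ab_group_add) series"
  assumes A: "additive_series A" and B: "additive_series B"
    and fin: "\<And>n v. finite {i. A i (B (n - i) v) \<noteq> 0}"
  shows "additive_series (A \<star> B)"
  unfolding additive_series_def smul_def
proof (intro allI)
  fix n u v
  have *: "(\<lambda>i. A i (B (n - i) (u + v))) = (\<lambda>i. A i (B (n - i) u) + A i (B (n - i) v))"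
    using A B by (simp add: additive_series_def)
  show "Sum_any (\<lambda>i. A i (B (n - i) (u + v))) =
      Sum_any (\<lambda>i. A i (B (n - i) u)) + Sum_any (\<lambda>i. A i (B (n - i) v))"
    unfolding * by (rule Sum_any.distrib[OF fin fin])
qed

lemma finite_smul_support:
  fixes A B :: "('e::ab_group_add) series"
  assumes "additive_series A" "finite_series B"
  shows "finite {i. A i (B (n - i) v) \<noteq> 0}"
proof (rule finite_subset)
  show "{i. A i (B (n - i) v) \<noteq> 0} \<subseteq> (\<lambda>j. n - j) ` {j. B j v \<noteq> 0}"
  proof
    fix i assume "i \<in> {i. A i (B (n - i) v) \<noteq> 0}"
    then have "B (n - i) v \<noteq> 0"
      using additive_series_0[OF assms(1)] by auto
    then show "i \<in> (\<lambda>j. n - j) ` {j. B j v \<noteq> 0}"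
      by (intro image_eqI[of _ _ "n - i"]) auto
  qed
qed (use assms(2) in \<open>simp add: finite_series_def\<close>)

lemma additive_smul_finite:
  fixes A B :: "('e::ab_group_add) series"
  assumes "additive_series A" "additive_series B" "finite_series B"
  shows "additive_series (A \<star> B)"
  using assms by (intro additive_smul finite_smul_support)

lemma finite_smul:
  fixes A B :: "('e::ab_group_add) series"
  assumes "additive_series A" "finite_series A" "finite_series B"
  shows "finite_series (A \<star> B)"
  unfolding finite_series_def
proof
  fix v
  let ?S = "\<Union>j\<in>{j. B j v \<noteq> 0}. (\<lambda>i. i + j) ` {i. A i (B j v) \<noteq> 0}"
  have "{n. (A \<star> B) n v \<noteq> 0} \<subseteq> ?S"
  proof
    fix n assume "n \<in> {n. (A \<star> B) n v \<noteq> 0}"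
    then obtain i where i: "A i (B (n - i) v) \<noteq> 0"
      unfolding smul_def by (auto elim: Sum_any.not_neutral_obtains_not_neutral)
    then have "B (n - i) v \<noteq> 0"
      using additive_series_0[OF assms(1)] by auto
    with i show "n \<in> ?S"
      by (intro UN_I[of "n - i"] image_eqI[of _ _ i]) auto
  qed
  moreover have "finite ?S"
    using assms(2,3) by (auto simp: finite_series_def)
  ultimately show "finite {n. (A \<star> B) n v \<noteq> 0}"
    by (rule finite_subset)
qed

lemma additive_emb: "additive_series (emb s f)"
  by (simp add: additive_series_def emb_def)

lemma finite_emb:
  assumes "s = 1 \<or> s = - 1" "locally_finite f"
  shows "finite_series (emb s f)"
  unfolding finite_series_def
proof
  fix v
  have "{n. emb s f n v \<noteq> 0} \<subseteq> (\<lambda>n. s * int n) ` {n. ap (f $ n) v \<noteq> 0}"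
  proof
    fix n assume n: "n \<in> {n. emb s f n v \<noteq> 0}"
    then have "n = s * int (nat (s * n))" "ap (f $ nat (s * n)) v \<noteq> 0"
      using assms(1) by (auto simp: emb_def coeff_at_def split: if_splits)
    then show "n \<in> (\<lambda>n. s * int n) ` {n. ap (f $ n) v \<noteq> 0}"
      by blast
  qed
  then show "finite {n. emb s f n v \<noteq> 0}"
    using assms(2) unfolding locally_finite_def by (meson finite_imageI finite_subset)
qed

lemma additive_factor_series: "additive_series (factor_series f)"
proof (cases f)
  case (Creation c)
  show ?thesis unfolding Creation factor_series_Creation by (rule additive_emb)
next
  case (Annihilation c)
  show ?thesis unfolding Annihilation factor_series_Annihilation by (rule additive_emb)
next
  case Lattice
  show ?thesis unfolding Lattice factor_series_Lattice by (simp add: additive_series_def)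
next
  case Grading
  show ?thesis unfolding Grading factor_series_Grading by (simp add: additive_series_def)
qed

lemma finite_factor_series:
  assumes "\<And>c. f \<noteq> Creation c"
  shows "finite_series (factor_series f)"
proof (cases f)
  case (Annihilation c)
  show ?thesis
    unfolding Annihilation factor_series_Annihilation
    by (simp add: finite_emb locally_finite_fexp_ann)
next
  case Lattice
  show ?thesis
    unfolding Lattice finite_series_def
  proof
    fix v
    show "finite {n. factor_series Lattice n v \<noteq> 0}"
      by (rule finite_subset[of _ "{0}"]) auto
  qed
next
  case Grading
  show ?thesis
    unfolding Grading finite_series_def
  proof
    fix v
    show "finite {n. factor_series Grading n v \<noteq> 0}"
      by (rule finite_subset[of _ "Poly_Mapping.keys v"]) (auto simp: in_keys_iff)
  qed
qed (use assms in simp)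

lemma additive_at_var: "additive_series A \<Longrightarrow> additive_series (at_var z A)"
  by (cases z) (auto simp: additive_series_def)

lemma finite_at_var:
  assumes "finite_series A"
  shows "finite_series (at_var z A)"
  unfolding finite_series_def
proof
  fix v
  have fin: "finite {n. A n v \<noteq> 0}"
    using assms by (simp add: finite_series_def)
  show "finite {n. at_var z A n v \<noteq> 0}"
  proof (cases z)
    case Z1
    have "{n. at_var z A n v \<noteq> 0} \<subseteq> (\<lambda>m. (m, 0)) ` {n. A n v \<noteq> 0}"
      by (auto simp: Z1 split: if_splits)
    then show ?thesis using fin finite_surj by blast
  next
    case Z2
    have "{n. at_var z A n v \<noteq> 0} \<subseteq> (\<lambda>m. (0, m)) ` {n. A n v \<noteq> 0}"
      by (auto simp: Z2 split: if_splits)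
    then show ?thesis using fin finite_surj by blast
  qed
qed

lemma additive_sone: "additive_series (sone :: ('e::ab_group_add) series)"
  by (simp add: additive_series_def sone_def)

lemma finite_sone: "finite_series (sone :: ('e::ab_group_add) series)"
  by (auto simp: finite_series_def sone_def)

lemma sprod_Cons: "sprod (A # As) = A \<star> sprod As"
  by (simp add: sprod_def)

lemma sprod_Nil: "sprod [] = sone"
  by (simp add: sprod_def)

lemma additive_finite_sprod:
  assumes "\<And>A. A \<in> set As \<Longrightarrow> additive_series A \<and> finite_series A"
  shows "additive_series (sprod As) \<and> finite_series (sprod As)"
  using assms
  by (induction As)
     (simp_all add: sprod_Nil sprod_Cons additive_sone finite_sone additive_smul_finite finite_smul)

lemma smul_sone:
  assumes "additive_series A"
  shows "A \<star> sone = (A :: ('e::ab_group_add) series)"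
proof (intro ext)
  fix n v
  have *: "(\<lambda>i. A i (sone (n - i) v)) = (\<lambda>i. if i = n then A i v else 0)"
    by (auto simp: sone_def additive_series_0[OF assms])
  show "(A \<star> sone) n v = A n v"
    unfolding smul_def * by (rule Sum_any.delta)
qed

text \<open>Serves for sums over pairs of exponents concentrated on one coordinate axis, as for a
  series in a single variable.\<close>

lemma Sum_any_image:
  assumes "inj f" "\<And>x. g (f x) = h x" "\<And>y. y \<notin> range f \<Longrightarrow> g y = 0"
  shows "Sum_any g = Sum_any h"
proof -
  have supp: "{y. g y \<noteq> 0} = f ` {x. h x \<noteq> 0}"
    using assms(2,3) by (auto simp: image_iff) metis
  show ?thesis
    unfolding Sum_any.expand_set supp
    using assms(1,2) by (subst sum.reindex) (auto intro: inj_on_subset)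
qed

lemma at_var_Z1_smul:
  assumes "additive_series A"
  shows "(at_var Z1 A \<star> X) (m, n) v = Sum_any (\<lambda>i. A i (X (m - i, n) v))"
  unfolding smul_def by (rule Sum_any_image[of "\<lambda>i. (i, 0)"]) (auto intro: injI)

lemma at_var_Z2_smul:
  assumes "additive_series A"
  shows "(at_var Z2 A \<star> X) (m, n) v = Sum_any (\<lambda>i. A i (X (m, n - i) v))"
  unfolding smul_def by (rule Sum_any_image[of "\<lambda>i. (0, i)"]) (auto intro: injI)

section \<open>The current on homogeneous vectors\<close>

text \<open>Multiplication by t = zw lowers both indices by 1, so the terms of 1 - 2t + t^2 appear
  as shifts by 0, 1 and 2.\<close>

lemma vertex_commutation_coeff:
  assumes "translates B g" "\<And>n. n \<ge> 1 \<Longrightarrow> b n * g n = - 2 / of_nat n"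
  defines "C \<equiv> fexp (cre_fps b)"
  shows "coeff_at B m * coeff_at C n = coeff_at C n * coeff_at B m
    - (coeff_at C (n - 1) * coeff_at B (m - 1) + coeff_at C (n - 1) * coeff_at B (m - 1))
    + coeff_at C (n - 2) * coeff_at B (m - 2)"
proof (cases "m < 0 \<or> n < 0")
  case True
  then show ?thesis by (auto simp: coeff_at_def)
next
  case False
  let ?w = "fps_const fps_X :: endo fps fps"
  define W where "W = const_coeffs C * fps_const B"
  define t where "t = ?w * fps_X"
  have t: "(t * U) $ i $ j = (if i = 0 \<or> j = 0 then 0 else U $ (i - 1) $ (j - 1))" for U i j
    by (simp add: t_def mult.assoc)
  have "fps_const B * const_coeffs C = (1 - t)\<^sup>2 * W"
    unfolding t_def W_def C_def using assms(1,2) by (rule vertex_commutation)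
  also have "\<dots> = W - (t * W + t * W) + t * (t * W)"
    by (simp add: power2_eq_square algebra_simps)
  finally have eq: "(fps_const B * const_coeffs C) $ i $ j = (W - (t * W + t * W) + t * (t * W)) $ i $ j"
    for i j by simp
  have W: "W $ i $ j = C $ i * B $ j" for i j
    by (simp add: W_def const_coeffs_def)
  show ?thesis
    using False eq[of "nat n" "nat m"]
    by (auto simp: coeff_at_def t W const_coeffs_def nat_diff_distrib numeral_2_eq_2)
qed

text \<open>On weight k the grading operator is multiplication by z^k, so it contributes no
  summation index.\<close>

definition homogeneous :: "int \<Rightarrow> L \<Rightarrow> bool"
  where "homogeneous k v \<longleftrightarrow> ap (proj k) v = v"

lemma homogeneous_single: "homogeneous k (Poly_Mapping.single k p)"
  by (simp add: homogeneous_def proj.rep_eq)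

lemma ap_proj_homogeneous:
  assumes "homogeneous k v"
  shows "ap (proj n) v = (if n = k then v else 0)"
proof -
  have "ap (proj n) (ap (proj k) v) = (if n = k then ap (proj k) v else 0)"
    by (simp add: proj.rep_eq lookup_single)
  then show ?thesis
    using assms by (simp add: homogeneous_def)
qed

lemma homogeneous_ap:
  assumes "homogeneous k v" "proj k * f = f * proj k"
  shows "homogeneous k (ap f v)"
  using assms by (metis ap_mult homogeneous_def)

lemma homogeneous_lat:
  assumes "homogeneous k v"
  shows "homogeneous (k + 2) (ap lat v)"
proof -
  have "ap (proj (k + 2)) (ap lat (ap (proj k) v)) = ap lat (ap (proj k) v)"
    by (simp add: proj.rep_eq lat.rep_eq mult_single add.commute)
  then show ?thesis
    using assms by (simp add: homogeneous_def)
qed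

lemma ap_nonzeroD: "ap f v \<noteq> 0 \<Longrightarrow> v \<noteq> 0"
  by auto

lemma commute_coeff_at:
  assumes "\<And>n. x * f $ n = f $ n * x"
  shows "x * coeff_at f n = coeff_at f n * x"
  by (simp add: coeff_at_def assms)

lemma commute_mult_nth:
  fixes f g :: "'a::ring_1 fps"
  assumes "\<And>n. x * f $ n = f $ n * x" "\<And>n. x * g $ n = g $ n * x"
  shows "x * (f * g) $ n = (f * g) $ n * x"
proof -
  have "x * (f $ i * g $ j) = f $ i * g $ j * x" for i j
    by (metis assms mult.assoc)
  then show ?thesis
    by (simp add: fps_mult_nth sum_distrib_left sum_distrib_right)
qed

lemma locally_finite_mult:
  assumes "locally_finite f" "locally_finite g"
  shows "locally_finite (f * g)"
proof -
  have "finite_series (emb 1 (f * g))"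
    using assms by (simp add: finite_smul additive_emb finite_emb flip: emb_mult)
  then have "finite {n. emb 1 (f * g) n v \<noteq> 0}" for v
    by (simp add: finite_series_def)
  then have "finite (int -` {n. emb 1 (f * g) n v \<noteq> 0})" for v
    by (rule finite_vimageI) simp
  then show ?thesis
    by (simp add: locally_finite_def emb_def coeff_at_def vimage_def)
qed

lemma locally_finite_bound:
  assumes "locally_finite f"
  obtains M where "\<And>n. ap (coeff_at f n) v \<noteq> 0 \<Longrightarrow> n \<in> {0..M}"
proof -
  have fin: "finite {n. ap (f $ n) v \<noteq> 0}"
    using assms by (simp add: locally_finite_def)
  show thesis
  proof (rule that)
    fix n assume "ap (coeff_at f n) v \<noteq> 0"
    then have "n \<ge> 0" "nat n \<in> {n. ap (f $ n) v \<noteq> 0}"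
      by (auto simp: coeff_at_def split: if_splits)
    with Max_ge[OF fin, of "nat n"] show "n \<in> {0..int (Max {n. ap (f $ n) v \<noteq> 0})}"
      by auto
  qed
qed

text \<open>Since f and g commute, either may act on v first, so each index is bounded in terms of v
  alone.\<close>

lemma locally_finite_bound2:
  assumes "locally_finite f" "locally_finite g" "\<And>i j. f $ i * g $ j = g $ j * f $ i"
  obtains M where
    "\<And>i j. ap (coeff_at f i) (ap (coeff_at g j) v) \<noteq> 0 \<Longrightarrow> i \<in> {0..M} \<and> j \<in> {0..M}"
proof -
  obtain M1 where M1: "\<And>n. ap (coeff_at f n) v \<noteq> 0 \<Longrightarrow> n \<in> {0..M1}"
    using locally_finite_bound[OF assms(1), where v = v] by blast
  obtain M2 where M2: "\<And>n. ap (coeff_at g n) v \<noteq> 0 \<Longrightarrow> n \<in> {0..M2}"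
    using locally_finite_bound[OF assms(2), where v = v] by blast
  show thesis
  proof (rule that)
    fix i j assume nz: "ap (coeff_at f i) (ap (coeff_at g j) v) \<noteq> 0"
    have "coeff_at f i * coeff_at g j = coeff_at g j * coeff_at f i"
      by (simp add: coeff_at_def assms(3))
    then have "ap (coeff_at f i) (ap (coeff_at g j) v) = ap (coeff_at g j) (ap (coeff_at f i) v)"
      by (metis ap_mult)
    with nz have "ap (coeff_at f i) v \<noteq> 0" "ap (coeff_at g j) v \<noteq> 0"
      by auto
    with M1 M2 show "i \<in> {0..max M1 M2} \<and> j \<in> {0..max M1 M2}"
      by fastforce
  qed
qed

section \<open>The factors of the current\<close>

definition b_plus :: "nat \<Rightarrow> F"
  where "b_plus r = qhalf powi (- int r) / qint (int r)"

definition d_hat :: "nat \<Rightarrow> F"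
  where "d_hat r = (q - inverse q) * (- (qhalf ^ r) / (1 + q ^ (2 * r)))"

definition C_hat :: "endo fps"
  where "C_hat = fexp (cre_fps b_plus)"

definition A_hat :: "endo fps"
  where "A_hat = fexp (ann_fps (\<lambda>r. - b_plus r))"

definition K_hat :: "endo fps"
  where "K_hat = fexp (ann_fps d_hat)"

text \<open>\<open>K_hat\<close> can join \<open>A_hat\<close> because its coefficients commute with
  e^\<alpha> and with the grading.\<close>

definition B_hat :: "endo fps"
  where "B_hat = A_hat * K_hat"

abbreviation "cC n \<equiv> coeff_at C_hat n"
abbreviation "cA n \<equiv> coeff_at A_hat n"
abbreviation "cK n \<equiv> coeff_at K_hat n"
abbreviation "cB n \<equiv> coeff_at B_hat n"

lemma B_hat_C_hat:
  "cB m * cC n = cC n * cB m - (cC (n - 1) * cB (m - 1) + cC (n - 1) * cB (m - 1))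
    + cC (n - 2) * cB (m - 2)"
  unfolding C_hat_def
proof (rule vertex_commutation_coeff)
  show "translates B_hat (\<lambda>s. - b_plus s * heis_norm s + d_hat s * heis_norm s)"
    unfolding B_hat_def A_hat_def K_hat_def by (intro translates_mult translates_fexp_ann)
  show "b_plus n * (- b_plus n * heis_norm n + d_hat n * heis_norm n) = - 2 / of_nat n" if "n \<ge> 1" for n
    unfolding b_plus_def d_hat_def using that by (rule contraction_coefficient)
qed

lemma commute_A_K: "A_hat $ i * K_hat $ j = K_hat $ j * A_hat $ i"
  unfolding A_hat_def K_hat_def by (rule fexp_ann_ann)

lemma commute_B_B: "B_hat $ i * B_hat $ j = B_hat $ j * B_hat $ i"
  unfolding B_hat_def A_hat_def K_hat_def
  by (intro commute_mult_nth commute_mult_nth[symmetric] fexp_ann_ann)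

lemma commute_C_C: "cC i * cC j = cC j * cC i"
  unfolding C_hat_def by (intro commute_coeff_at commute_coeff_at[symmetric] fexp_cre_cre)

lemma commute_lat:
  "lat * cC i = cC i * lat" "lat * cA i = cA i * lat" "lat * cK i = cK i * lat" "lat * cB i = cB i * lat"
  unfolding C_hat_def A_hat_def K_hat_def B_hat_def
  by (intro commute_coeff_at commute_mult_nth commute_fexp_cre commute_fexp_ann lat_cre lat_ann)+

lemma commute_proj:
  "proj k * cC i = cC i * proj k" "proj k * cA i = cA i * proj k" "proj k * cK i = cK i * proj k"
  "proj k * cB i = cB i * proj k"
  unfolding C_hat_def A_hat_def K_hat_def B_hat_def
  by (intro commute_coeff_at commute_mult_nth commute_fexp_cre commute_fexp_ann proj_cre proj_ann)+

lemma locally_finite_hat: "locally_finite A_hat" "locally_finite K_hat" "locally_finite B_hat"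
  unfolding B_hat_def A_hat_def K_hat_def
  by (intro locally_finite_mult locally_finite_fexp_ann)+

lemma x_plus_eq:
  "x_plus = emb 1 C_hat \<star> (emb (- 1) A_hat \<star> (factor_series Lattice \<star> factor_series Grading))"
  unfolding x_plus_def x_plus_factors_def C_hat_def A_hat_def b_plus_def
  by (simp only: list.map sprod_Cons sprod_Nil factor_series_Creation factor_series_Annihilation
      smul_sone[OF additive_factor_series])

lemma k_hat_eq: "k_hat = emb (- 1) K_hat"
  unfolding k_hat_def k_hat_factors_def K_hat_def d_hat_def
  by (simp only: list.map sprod_Cons sprod_Nil factor_series_Annihilation
      smul_sone[OF additive_emb])

text \<open>Exponents add up: k from the grading, i from creation and -j from annihilation, so the
  coefficient of z^n forces j = k - n + i.\<close>

lemma x_plus_homogeneous: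
  assumes "homogeneous k v"
  shows "x_plus n v = Sum_any (\<lambda>i. ap (cC i) (ap (cA (k - n + i)) (ap lat v)))"
proof -
  have LG: "(factor_series Lattice \<star> factor_series Grading) n v = (if n = k then ap lat v else 0)" for n
  proof -
    have *: "(\<lambda>i. factor_series Lattice i (factor_series Grading (n - i) v)) =
        (\<lambda>i. if i = 0 then (if n - i = k then ap lat v else 0) else 0)"
      unfolding factor_series_Lattice factor_series_Grading
      by (simp add: ap_proj_homogeneous[OF assms] fun_eq_iff)
    show ?thesis
      unfolding smul_def * Sum_any.delta by simp
  qed
  have ALG: "(emb (- 1) A_hat \<star> (factor_series Lattice \<star> factor_series Grading)) n v =
      ap (cA (k - n)) (ap lat v)" for n
  proof -
    have *: "(\<lambda>i. emb (- 1) A_hat i ((factor_series Lattice \<star> factor_series Grading) (n - i) v)) =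
        (\<lambda>i. if i = n - k then ap (cA (- i)) (ap lat v) else 0)"
      by (auto simp: LG emb_def fun_eq_iff simp del: factor_series.simps)
    show ?thesis
      unfolding smul_def[of "emb (- 1) A_hat"] * Sum_any.delta by simp
  qed
  show ?thesis
    unfolding x_plus_eq smul_def[of "emb 1 C_hat"] ALG by (simp add: emb_def algebra_simps)
qed

lemma additive_finite_LG_chain:
  "additive_series (emb (- 1) A_hat \<star> (factor_series Lattice \<star> factor_series Grading))"
  "finite_series (emb (- 1) A_hat \<star> (factor_series Lattice \<star> factor_series Grading))"
  by (intro additive_smul_finite finite_smul additive_emb finite_emb additive_factor_series
      finite_factor_series locally_finite_hat; simp)+

lemma additive_x_hat: "additive_series x_hat"
  unfolding x_hat_def x_plus_eq k_hat_eq
  by (intro additive_smul_finite[of "_ \<star> _" "emb _ K_hat"] additive_smul_finite[of "emb 1 C_hat"]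
      additive_finite_LG_chain additive_emb finite_emb locally_finite_hat; simp)

text \<open>The operators of \<open>k_hat\<close> act first but commute with \<open>lat\<close> and
  preserve weights. They can thus be moved next to those of \<open>A_hat\<close>, with which they
  convolve to \<open>B_hat\<close>.\<close>

lemma x_hat_homogeneous:
  assumes v: "homogeneous k v"
  shows "x_hat n v = Sum_any (\<lambda>i. ap (cC i) (ap (cB (k - n + i)) (ap lat v)))"
proof -
  let ?w = "ap lat v"
  let ?g = "\<lambda>t i. ap (cC i) (ap (cA (k - n + t + i)) (ap (cK (- t)) ?w))"
  obtain M where M: "\<And>i j. ap (cA i) (ap (cK j) ?w) \<noteq> 0 \<Longrightarrow> i \<in> {0..M} \<and> j \<in> {0..M}"
    using locally_finite_bound2[OF locally_finite_hat(1,2) commute_A_K, where v = ?w] by blast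
  have x_plus_K: "x_plus (n - t) (ap (cK (- t)) v) = Sum_any (?g t)" for t
  proof -
    have "homogeneous k (ap (cK (- t)) v)"
      using v commute_proj(3) by (rule homogeneous_ap)
    moreover have "ap lat (ap (cK (- t)) v) = ap (cK (- t)) ?w"
      using commute_lat(3) by (metis ap_mult)
    ultimately show ?thesis
      by (simp add: x_plus_homogeneous algebra_simps)
  qed
  have "bij (\<lambda>t. n - t)"
    by (rule o_bij[of "\<lambda>t. n - t"]) (auto simp: fun_eq_iff)
  then have "x_hat n v = Sum_any (\<lambda>t. Sum_any (?g t))"
    unfolding x_hat_def k_hat_eq smul_def[of x_plus]
    by (rule Sum_any.reindex_cong) (auto simp: fun_eq_iff emb_def x_plus_K)
  also have "\<dots> = Sum_any (\<lambda>i. Sum_any (\<lambda>t. ?g t i))"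
  proof (rule Sum_any.swap)
    have "-t \<in> {0..M} \<and> k - n + t + i \<in> {0..M}" if "?g t i \<noteq> 0" for t i
      using M[OF ap_nonzeroD[OF that]] by auto
    \<comment> \<open>Both -t and k - n + t + i lie in 0..M, so i ranges over an interval of length
      2M. This box justifies exchanging the sums.\<close>
    then have "t \<in> {-M..0} \<and> i \<in> {n - k..n - k + 2 * M}" if "?g t i \<noteq> 0" for t i
      using that by fastforce
    then show "{t. \<exists>i. ?g t i \<noteq> 0} \<times> {i. \<exists>t. ?g t i \<noteq> 0} \<subseteq> {-M..0} \<times> {n - k..n - k + 2 * M}"
      by blast
  qed simp
  also have "(\<lambda>i. Sum_any (\<lambda>t. ?g t i)) = (\<lambda>i. ap (cC i) (ap (cB (k - n + i)) ?w))"
  proof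
    fix i
    let ?h = "\<lambda>j. ap (cA j) (ap (cK (k - n + i - j)) ?w)"
    have "Sum_any (\<lambda>t. ?g t i) = Sum_any (\<lambda>j. ap (cC i) (?h j))"
    proof (rule Sum_any.reindex_cong[symmetric])
      show "bij (\<lambda>t. k - n + i + t)"
        by (rule o_bij[of "\<lambda>j. j - (k - n + i)"]) (auto simp: fun_eq_iff)
    qed (auto simp: fun_eq_iff algebra_simps)
    also have "\<dots> = ap (cC i) (Sum_any ?h)"
    proof (rule ap_Sum_any[symmetric])
      show "finite {j. ?h j \<noteq> 0}"
        by (rule finite_subset[of _ "{0..M}"]) (use M in auto)
    qed
    also have "Sum_any ?h = ap (cB (k - n + i)) ?w"
      unfolding B_hat_def by (rule coeff_at_mult)
    finally show "Sum_any (\<lambda>t. ?g t i) = ap (cC i) (ap (cB (k - n + i)) ?w)" .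
  qed
  finally show ?thesis .
qed

section \<open>Normal ordering\<close>

text \<open>The coefficient of \<open>z\<^sub>1\<^sup>m z\<^sub>2\<^sup>n\<close> in the normally ordered product on a vector of weight \<open>k\<close>,
  where \<open>u\<close> is that vector shifted by \<open>e\<^sup>2\<^sup>\<alpha>\<close>.\<close>

definition normal_coeff :: "int \<Rightarrow> L \<Rightarrow> int \<Rightarrow> int \<Rightarrow> L"
  where "normal_coeff k u m n =
    Sum_any (\<lambda>(i, j). ap (cC i) (ap (cC j) (ap (cB (k - m + i)) (ap (cB (k - n + j)) u))))"

text \<open>The summation indices enter the annihilation operators, which local finiteness confines
  to a box. Arbitrary f and g cover the shifted creation indices produced by commutation as
  well.\<close>

lemma finite_normal_support:
  fixes f g :: "int \<Rightarrow> int \<Rightarrow> endo"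
  shows "finite {(i, j). ap (f i j) (ap (g i j) (ap (cB (a + i)) (ap (cB (b + j)) u))) \<noteq> 0}"
proof -
  obtain M where M: "\<And>i j. ap (cB i) (ap (cB j) u) \<noteq> 0 \<Longrightarrow> i \<in> {0..M} \<and> j \<in> {0..M}"
    using locally_finite_bound2[OF locally_finite_hat(3,3) commute_B_B, where v = u] by blast
  have "(i, j) \<in> {-a..M - a} \<times> {-b..M - b}" if "ap (cB (a + i)) (ap (cB (b + j)) u) \<noteq> 0" for i j
    using M[OF that] by auto
  then have "{(i, j). ap (f i j) (ap (g i j) (ap (cB (a + i)) (ap (cB (b + j)) u))) \<noteq> 0} \<subseteq>
      {-a..M - a} \<times> {-b..M - b}"
    by (blast dest: ap_nonzeroD)
  then show ?thesis
    by (rule finite_subset) simp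
qed

lemma Sum_any_Sum_any:
  assumes "finite {(i, j). g i j \<noteq> 0}"
  shows "Sum_any (\<lambda>i. Sum_any (g i)) = Sum_any (\<lambda>(i, j). g i j)"
proof (rule Sum_any.cartesian_product)
  let ?S = "{(i, j). g i j \<noteq> 0}"
  show "finite (fst ` ?S \<times> snd ` ?S)"
    using assms by simp
  show "{i. \<exists>j. g i j \<noteq> 0} \<times> {j. \<exists>i. g i j \<noteq> 0} \<subseteq> fst ` ?S \<times> snd ` ?S"
    by force
qed

text \<open>Interchanging i and j is undone by commuting the two creation coefficients and the two
  annihilation coefficients.\<close>

lemma normal_coeff_swap: "normal_coeff k u m n = normal_coeff k u n m"
  unfolding normal_coeff_def
proof (rule Sum_any.reindex_cong[of prod.swap, symmetric])
  have CC: "ap (cC i) (ap (cC j) w) = ap (cC j) (ap (cC i) w)" for i j w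
    by (metis ap_mult commute_C_C)
  have "cB i * cB j = cB j * cB i" for i j
    by (intro commute_coeff_at commute_coeff_at[symmetric] commute_B_B)
  then have BB: "ap (cB i) (ap (cB j) w) = ap (cB j) (ap (cB i) w)" for i j w
    by (metis ap_mult)
  show "(\<lambda>(i, j). ap (cC i) (ap (cC j) (ap (cB (k - n + i)) (ap (cB (k - m + j)) u)))) \<circ> prod.swap =
      (\<lambda>(i, j). ap (cC i) (ap (cC j) (ap (cB (k - m + i)) (ap (cB (k - n + j)) u))))"
  proof (rule ext, clarsimp)
    fix i j
    show "ap (cC j) (ap (cC i) (ap (cB (k - n + j)) (ap (cB (k - m + i)) u))) =
        ap (cC i) (ap (cC j) (ap (cB (k - m + i)) (ap (cB (k - n + j)) u)))"
      by (subst CC, subst BB) (rule refl)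
  qed
qed simp

text \<open>Only j is translated: c stays in the index of an annihilation coefficient, while d moves
  to a creation coefficient. This is the form in which \<open>B_hat_C_hat\<close> delivers its
  terms.\<close>

lemma normal_coeff_shift:
  "normal_coeff k u (m - c) (n - d) = Sum_any (\<lambda>(i, j). ap (cC i) (ap (cC (j - d))
    (ap (cB (k - m + c + i)) (ap (cB (k - n + j)) u))))"
  unfolding normal_coeff_def
proof (rule Sum_any.reindex_cong[symmetric])
  show "bij (\<lambda>(i, j). (i, j + d))"
    by (rule o_bij[of "\<lambda>(i, j). (i, j - d)"]) (auto simp: fun_eq_iff)
qed (auto simp: fun_eq_iff algebra_simps)

lemma finite_plus_support:
  assumes "finite {x. f x \<noteq> 0}" "finite {x. g x \<noteq> (0::'a::monoid_add)}"
  shows "finite {x. f x + g x \<noteq> 0}"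
  by (rule finite_subset[of _ "{x. f x \<noteq> 0} \<union> {x. g x \<noteq> 0}"]) (use assms in auto)

lemma additive_series_sum:
  assumes "additive_series X"
  shows "X n (sum f S) = (\<Sum>i\<in>S. X n (f i))"
  using assms
  by (induction S rule: infinite_finite_induct) (simp_all add: additive_series_0 additive_series_def)

text \<open>The right current raises the weight to k + 2, so the left one carries the annihilation
  index k + 2 - m + i. The three terms of \<open>B_hat_C_hat\<close> lower it by 0, 1, 2 together
  with the creation index j, which gives the exponents (2,0), (1,1), (0,2) of (z1 - z2)^2.\<close>

lemma x_hat_x_hat_homogeneous:
  assumes v: "homogeneous k v"
  defines "u \<equiv> ap lat (ap lat v)"
  shows "x_hat m (x_hat n v) = normal_coeff k u (m - 2) n
    - (normal_coeff k u (m - 1) (n - 1) + normal_coeff k u (m - 1) (n - 1)) + normal_coeff k u m (n - 2)"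
proof -
  let ?w = "ap lat v"
  define y where "y j = ap (cC j) (ap (cB (k - n + j)) ?w)" for j
  \<comment> \<open>\<open>T c d\<close> is the summand for z1^c z2^d times the normally ordered
    product, arranged so that all three share the inner vector
    \<open>ap (cB (k - n + j)) u\<close>.\<close>
  define T where "T c d = (\<lambda>(i, j). ap (cC i) (ap (cC (j - d)) (ap (cB (k - m + c + i)) (ap (cB (k - n + j)) u))))"
    for c d
  have T_sum: "Sum_any (T c d) = normal_coeff k u (m - c) (n - d)" for c d
    by (simp only: T_def normal_coeff_shift)
  have T_fin: "finite {p. T c d p \<noteq> 0}" for c d
    using finite_normal_support[of "\<lambda>i j. cC i" "\<lambda>i j. cC (j - d)" "k - m + c" "k - n" u]
    by (simp add: T_def case_prod_beta')
  define R where "R p = T 2 0 p - (T 1 1 p + T 1 1 p) + T 0 2 p" for p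
  have y_fin: "finite {j. y j \<noteq> 0}"
  proof -
    obtain M where M: "\<And>j. ap (cB j) ?w \<noteq> 0 \<Longrightarrow> j \<in> {0..M}"
      using locally_finite_bound[OF locally_finite_hat(3), where v = ?w] by blast
    have "j \<in> {n - k..n - k + M}" if "y j \<noteq> 0" for j
      using M[OF ap_nonzeroD[OF that[unfolded y_def]]] by auto
    then have "{j. y j \<noteq> 0} \<subseteq> {n - k..n - k + M}"
      by blast
    then show ?thesis
      by (rule finite_subset) simp
  qed
  have x_y: "x_hat m (y j) = Sum_any (\<lambda>i. R (i, j))" for j
  proof -
    have "homogeneous (k + 2) (y j)"
      unfolding y_def using v by (intro homogeneous_ap homogeneous_lat commute_proj)
    moreover have "ap lat (y j) = ap (cC j) (ap (cB (k - n + j)) u)"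
      unfolding y_def u_def using commute_lat(1,4) by (metis ap_mult)
    ultimately have "x_hat m (y j) =
        Sum_any (\<lambda>i. ap (cC i) (ap (cB (k + 2 - m + i)) (ap (cC j) (ap (cB (k - n + j)) u))))"
      by (simp add: x_hat_homogeneous)
    also have "(\<lambda>i. ap (cC i) (ap (cB (k + 2 - m + i)) (ap (cC j) (ap (cB (k - n + j)) u)))) = (\<lambda>i. R (i, j))"
    proof
      fix i
      let ?z = "ap (cB (k - n + j)) u" and ?a = "k - m + 2 + i"
      have a: "?a - 1 = k - m + 1 + i" "?a - 2 = k - m + 0 + i" "k + 2 - m + i = ?a"
        by auto
      have "ap (cB ?a) (ap (cC j) ?z) = ap (cC j) (ap (cB ?a) ?z)
          - (ap (cC (j - 1)) (ap (cB (k - m + 1 + i)) ?z) + ap (cC (j - 1)) (ap (cB (k - m + 1 + i)) ?z))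
          + ap (cC (j - 2)) (ap (cB (k - m + 0 + i)) ?z)"
        using arg_cong[OF B_hat_C_hat[of ?a j], of "\<lambda>f. ap f ?z"]
        by (simp only: ap_mult ap_plus ap_minus a)
      then show "ap (cC i) (ap (cB (k + 2 - m + i)) (ap (cC j) ?z)) = R (i, j)"
        by (simp only: a R_def T_def prod.case ap_add ap_diff diff_0_right)
    qed
    finally show ?thesis .
  qed
  have R_fin: "finite {p. R p \<noteq> 0}"
    by (rule finite_subset[of _ "{p. T 2 0 p \<noteq> 0} \<union> {p. T 1 1 p \<noteq> 0} \<union> {p. T 0 2 p \<noteq> 0}"])
       (auto simp: R_def T_fin)
  have "x_hat n v = Sum_any y"
    unfolding y_def by (rule x_hat_homogeneous[OF v])
  \<comment> \<open>The support of y is finite, so additivity suffices to pull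
    \<open>x_hat m\<close> through the sum.\<close>
  then have "x_hat m (x_hat n v) = x_hat m (\<Sum>j | y j \<noteq> 0. y j)"
    by (simp add: Sum_any.expand_set)
  also have "\<dots> = (\<Sum>j | y j \<noteq> 0. x_hat m (y j))"
    by (rule additive_series_sum[OF additive_x_hat])
  also have "\<dots> = Sum_any (\<lambda>j. x_hat m (y j))"
    using y_fin additive_series_0[OF additive_x_hat]
    by (intro Sum_any.expand_superset[symmetric]) auto
  also have "\<dots> = Sum_any (\<lambda>j. Sum_any (\<lambda>i. R (i, j)))"
    by (simp only: x_y)
  also have "\<dots> = Sum_any (\<lambda>(j, i). R (i, j))"
  proof (rule Sum_any_Sum_any)
    have "{(j, i). R (i, j) \<noteq> 0} = prod.swap ` {p. R p \<noteq> 0}"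
      by force
    then show "finite {(j, i). R (i, j) \<noteq> 0}"
      using R_fin by simp
  qed
  also have "\<dots> = Sum_any R"
    by (rule Sum_any.reindex_cong[of prod.swap, symmetric]) (auto simp: fun_eq_iff)
  also have "\<dots> = Sum_any (T 2 0) + (Sum_any (\<lambda>p. - T 1 1 p) + (Sum_any (\<lambda>p. - T 1 1 p) + Sum_any (T 0 2)))"
  proof -
    have R: "R = (\<lambda>p. T 2 0 p + (- T 1 1 p + (- T 1 1 p + T 0 2 p)))"
      by (simp add: R_def fun_eq_iff)
    have f1: "finite {p. - T 1 1 p \<noteq> 0}"
      using T_fin by simp
    note f2 = finite_plus_support[OF f1 T_fin[of 0 2]]
    note f3 = finite_plus_support[OF f1 f2]
    show ?thesis
      unfolding R Sum_any.distrib[OF T_fin f3] Sum_any.distrib[OF f1 f2] Sum_any.distrib[OF f1 T_fin] ..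
  qed
  also have "Sum_any (\<lambda>p. - T 1 1 p) = - Sum_any (T 1 1)"
    by (simp add: Sum_any.expand_set sum_negf)
  finally show ?thesis
    by (simp add: T_sum)
qed

text \<open>As the sort is stable, the two annihilation series of each current become neighbours and
  can merge into \<open>B_hat\<close>.\<close>

lemma normal_order_x_hat:
  "normal_product (map (Pair Z1) x_hat_factors @ map (Pair Z2) x_hat_factors) =
    at_var Z1 (emb 1 C_hat) \<star> (at_var Z2 (emb 1 C_hat) \<star>
      sprod (map (\<lambda>(z, f). at_var z (factor_series f))
        [(Z1, Annihilation (\<lambda>r. - b_plus r)), (Z1, Annihilation d_hat),
         (Z2, Annihilation (\<lambda>r. - b_plus r)), (Z2, Annihilation d_hat),
         (Z1, Lattice), (Z2, Lattice), (Z1, Grading), (Z2, Grading)]))"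
proof -
  have fs: "x_hat_factors = [Creation b_plus, Annihilation (\<lambda>r. - b_plus r), Lattice, Grading, Annihilation d_hat]"
    by (simp add: x_hat_factors_def x_plus_factors_def k_hat_factors_def b_plus_def d_hat_def fun_eq_iff)
  have no: "normal_order (map (Pair Z1) x_hat_factors @ map (Pair Z2) x_hat_factors) =
      [(Z1, Creation b_plus), (Z2, Creation b_plus),
       (Z1, Annihilation (\<lambda>r. - b_plus r)), (Z1, Annihilation d_hat),
       (Z2, Annihilation (\<lambda>r. - b_plus r)), (Z2, Annihilation d_hat),
       (Z1, Lattice), (Z2, Lattice), (Z1, Grading), (Z2, Grading)]"
    unfolding fs normal_order_def by (simp add: sort_key_def)
  show ?thesis
    unfolding normal_product_def no C_hat_def
    by (simp only: list.map prod.case sprod_Cons factor_series_Creation)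
qed

lemma at_var_Z1_emb_smul:
  "(at_var Z1 (emb s f) \<star> X) (m, n) v = Sum_any (\<lambda>i. ap (coeff_at f (s * i)) (X (m - i, n) v))"
  by (subst at_var_Z1_smul[OF additive_emb]) (simp only: emb_def)

lemma at_var_Z2_emb_smul:
  "(at_var Z2 (emb s f) \<star> X) (m, n) v = Sum_any (\<lambda>i. ap (coeff_at f (s * i)) (X (m, n - i) v))"
  by (subst at_var_Z2_smul[OF additive_emb]) (simp only: emb_def)

lemma at_var_Lattice_smul:
  "(at_var z (factor_series Lattice) \<star> X) e v = ap lat (X e v)"
proof -
  have *: "(\<lambda>i. at_var z (factor_series Lattice) i (X (e - i) v)) =
      (\<lambda>i. if i = 0 then ap lat (X (e - i) v) else 0)"
    unfolding factor_series_Lattice by (cases z) (auto simp: fun_eq_iff zero_prod_def)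
  show ?thesis
    unfolding smul_def * Sum_any.delta by simp
qed

lemma Sum_any_coeff_at_single:
  "Sum_any (\<lambda>i. ap (coeff_at f (- i)) (if n - i = k then w else 0)) = ap (coeff_at f (k - n)) w"
proof -
  have *: "(\<lambda>i. ap (coeff_at f (- i)) (if n - i = k then w else 0)) =
      (\<lambda>i. if i = n - k then ap (coeff_at f (- i)) w else 0)"
    by (auto simp: fun_eq_iff)
  show ?thesis
    unfolding * Sum_any.delta by simp
qed

lemma Sum_any_coeff_at_coeff_at:
  "Sum_any (\<lambda>i. ap (coeff_at f (- i)) (ap (coeff_at g (k - (n - i))) w)) = ap (coeff_at (f * g) (k - n)) w"
proof -
  have "bij (\<lambda>i::int. - i)"
    by (rule o_bij[of "\<lambda>i. - i"]) auto
  then have "Sum_any (\<lambda>i. ap (coeff_at f i) (ap (coeff_at g (k - n - i)) w)) =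
      Sum_any (\<lambda>i. ap (coeff_at f (- i)) (ap (coeff_at g (k - (n - i))) w))"
    by (rule Sum_any.reindex_cong) (auto simp: fun_eq_iff algebra_simps)
  then show ?thesis
    by (simp add: coeff_at_mult)
qed

text \<open>Applying the factors from the innermost outwards avoids reassociating the product. Both
  gradings act before any e^\<alpha>, so both see weight k and leave the single exponent pair (k,
  k); each annihilation block then frees one of the two exponents.\<close>

lemma normal_product_homogeneous:
  assumes v: "homogeneous k v"
  shows "normal_product (map (Pair Z1) x_hat_factors @ map (Pair Z2) x_hat_factors) (m, n) v =
    normal_coeff k (ap lat (ap lat v)) m n"
proof -
  let ?u = "ap lat (ap lat v)"
  define Y5 where "Y5 = sprod (map (\<lambda>(z, f). at_var z (factor_series f)) [(Z1, Lattice), (Z2, Lattice), (Z1, Grading), (Z2, Grading)])"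
  have G: "(at_var Z1 (factor_series Grading) \<star> (at_var Z2 (factor_series Grading) \<star> sone)) (m, n) v =
      (if m = k \<and> n = k then v else 0)" for m n
  proof -
    have eq: "at_var Z2 (factor_series Grading) \<star> sone = at_var Z2 (factor_series Grading)"
      by (rule smul_sone[OF additive_at_var[OF additive_factor_series]])
    have *: "(\<lambda>i. factor_series Grading i (at_var Z2 (factor_series Grading) (m - i, n) v)) =
        (\<lambda>i. if i = m then (if m = k \<and> n = k then v else 0) else 0)"
      unfolding factor_series_Grading
      by (auto simp: fun_eq_iff ap_proj_homogeneous[OF v])
    show ?thesis
      unfolding eq at_var_Z1_smul[OF additive_factor_series] * Sum_any.delta ..
  qed
  have Y5: "Y5 (m, n) v = (if m = k \<and> n = k then ?u else 0)" for m n
    unfolding Y5_def by (simp add: sprod_Cons sprod_Nil at_var_Lattice_smul G del: factor_series.simps at_var.simps)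
  define Y4 where "Y4 = at_var Z2 (emb (- 1) K_hat) \<star> Y5"
  have Y4: "Y4 (m, n) v = (if m = k then ap (cK (k - n)) ?u else 0)" for m n
    unfolding Y4_def at_var_Z2_emb_smul Y5
    by (cases "m = k") (simp_all add: Sum_any_coeff_at_single)
  define Y3 where "Y3 = at_var Z2 (emb (- 1) A_hat) \<star> Y4"
  have Y3: "Y3 (m, n) v = (if m = k then ap (cB (k - n)) ?u else 0)" for m n
    unfolding Y3_def at_var_Z2_emb_smul Y4 B_hat_def
    by (cases "m = k") (simp_all add: Sum_any_coeff_at_coeff_at)
  define Y2 where "Y2 = at_var Z1 (emb (- 1) K_hat) \<star> Y3"
  have Y2: "Y2 (m, n) v = ap (cK (k - m)) (ap (cB (k - n)) ?u)" for m n
    unfolding Y2_def at_var_Z1_emb_smul Y3 by (simp add: Sum_any_coeff_at_single)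
  define Y1 where "Y1 = at_var Z1 (emb (- 1) A_hat) \<star> Y2"
  have Y1: "Y1 (m, n) v = ap (cB (k - m)) (ap (cB (k - n)) ?u)" for m n
    unfolding Y1_def at_var_Z1_emb_smul Y2 by (simp add: Sum_any_coeff_at_coeff_at B_hat_def)
  have "normal_product (map (Pair Z1) x_hat_factors @ map (Pair Z2) x_hat_factors) (m, n) v =
      (at_var Z1 (emb 1 C_hat) \<star> (at_var Z2 (emb 1 C_hat) \<star> Y1)) (m, n) v"
    unfolding normal_order_x_hat Y1_def Y2_def Y3_def Y4_def Y5_def A_hat_def K_hat_def
    by (simp only: list.map prod.case sprod_Cons factor_series_Annihilation)
  also have "\<dots> = Sum_any (\<lambda>i. ap (cC i) (Sum_any (\<lambda>j. ap (cC j) (ap (cB (k - m + i)) (ap (cB (k - n + j)) ?u)))))"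
    unfolding at_var_Z1_emb_smul at_var_Z2_emb_smul Y1 by (simp add: algebra_simps)
  also have "\<dots> = Sum_any (\<lambda>i. Sum_any (\<lambda>j. ap (cC i) (ap (cC j) (ap (cB (k - m + i)) (ap (cB (k - n + j)) ?u)))))"
  proof (intro Sum_any.cong ap_Sum_any)
    fix i
    let ?h = "\<lambda>j. ap (cC j) (ap (cB (k - m + i)) (ap (cB (k - n + j)) ?u))"
    \<comment> \<open>With the first operator taken to be 1, the two-index bound projects to a bound
      on j.\<close>
    have "finite (snd ` {(i, j). ap 1 (ap (cC j) (ap (cB (k - m + i)) (ap (cB (k - n + j)) ?u))) \<noteq> 0})"
      by (intro finite_imageI finite_normal_support)
    moreover have "{j. ?h j \<noteq> 0} \<subseteq> snd ` {(i, j). ap 1 (ap (cC j) (ap (cB (k - m + i)) (ap (cB (k - n + j)) ?u))) \<noteq> 0}"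
      by (auto simp: image_iff)
    ultimately show "finite {j. ?h j \<noteq> 0}"
      by (rule finite_subset[rotated])
  qed
  also have "\<dots> = normal_coeff k ?u m n"
    unfolding normal_coeff_def by (intro Sum_any_Sum_any finite_normal_support)
  finally show ?thesis .
qed

lemma additive_finite_sprod_factors:
  assumes "\<And>z f c. (z, f) \<in> set ws \<Longrightarrow> f \<noteq> Creation c"
  defines "Y \<equiv> sprod (map (\<lambda>(z, f). at_var z (factor_series f)) ws)"
  shows "additive_series Y \<and> finite_series Y"
  unfolding Y_def
proof (intro additive_finite_sprod conjI)
  fix A assume "A \<in> set (map (\<lambda>(z, f). at_var z (factor_series f)) ws)"
  then obtain z f where A: "A = at_var z (factor_series f)" and zf: "(z, f) \<in> set ws"
    by auto
  show "additive_series A" "finite_series A"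
    unfolding A using assms(1)[OF zf]
    by (intro additive_at_var additive_factor_series finite_at_var finite_factor_series; simp)+
qed

text \<open>The inner creation factor need not give a finite series, so the general criterion does
  not cover the outer one. But creation in z2 leaves the z1-exponent alone, and the remaining
  factors produce only finitely many of those on a given vector.\<close>

lemma additive_normal_product:
  "additive_series (normal_product (map (Pair Z1) x_hat_factors @ map (Pair Z2) x_hat_factors))"
proof -
  define Y where "Y = sprod (map (\<lambda>(z, f). at_var z (factor_series f))
        [(Z1, Annihilation (\<lambda>r. - b_plus r)), (Z1, Annihilation d_hat),
         (Z2, Annihilation (\<lambda>r. - b_plus r)), (Z2, Annihilation d_hat),
         (Z1, Lattice), (Z2, Lattice), (Z1, Grading), (Z2, Grading)])"
  have "additive_series Y \<and> finite_series Y"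
    unfolding Y_def by (rule additive_finite_sprod_factors) auto
  then have Y: "additive_series Y" "finite_series Y"
    by simp_all
  let ?X = "at_var Z2 (emb 1 C_hat) \<star> Y"
  have "additive_series (at_var Z1 (emb 1 C_hat) \<star> ?X)"
  proof (rule additive_smul)
    show "additive_series (at_var Z1 (emb 1 C_hat))"
      by (intro additive_at_var additive_emb)
    show "additive_series ?X"
      by (intro additive_smul_finite additive_at_var additive_emb Y)
    fix e :: "int \<times> int" and v
    obtain m n where e: "e = (m, n)" by fastforce
    have "{i. at_var Z1 (emb 1 C_hat) i (?X (e - i) v) \<noteq> 0} \<subseteq> (\<lambda>j. (m - fst j, 0)) ` {j. Y j v \<noteq> 0}"
    proof
      fix i assume "i \<in> {i. at_var Z1 (emb 1 C_hat) i (?X (e - i) v) \<noteq> 0}"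
      then obtain l where i: "i = (l, 0)" and "?X (m - l, n) v \<noteq> 0"
        by (cases i) (auto simp: e emb_def split: if_splits dest: ap_nonzeroD)
      then obtain j where "ap (cC j) (Y (m - l, n - j) v) \<noteq> 0"
        unfolding at_var_Z2_emb_smul by (auto elim: Sum_any.not_neutral_obtains_not_neutral)
      then have "Y (m - l, n - j) v \<noteq> 0"
        by (rule ap_nonzeroD)
      then show "i \<in> (\<lambda>j. (m - fst j, 0)) ` {j. Y j v \<noteq> 0}"
        by (intro image_eqI[of _ _ "(m - l, n - j)"]) (auto simp: i)
    qed
    then show "finite {i. at_var Z1 (emb 1 C_hat) i (?X (e - i) v) \<noteq> 0}"
      by (rule finite_subset) (use Y(2) in \<open>simp add: finite_series_def\<close>)
  qed
  then show ?thesis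
    unfolding normal_order_x_hat Y_def .
qed

section \<open>The polynomial factor and the comparison of both sides\<close>

lemma z1_minus_z2_eq: "z1_minus_z2 e v = (if e = (1, 0) then v else if e = (0, 1) then - v else 0)"
  by (cases e) (auto simp: z1_minus_z2_def zvar_def)

lemma z1_minus_z2_smul: "(z1_minus_z2 \<star> X) e v = X (e - (1, 0)) v - X (e - (0, 1)) v"
proof -
  have "(z1_minus_z2 \<star> X) e v = (\<Sum>i\<in>{(1, 0), (0, 1)}. z1_minus_z2 i (X (e - i) v))"
    unfolding smul_def by (rule Sum_any.expand_superset) (auto simp: z1_minus_z2_eq)
  then show ?thesis
    by (simp add: z1_minus_z2_eq)
qed

lemma spow_z1_minus_z2_smul:
  "(spow z1_minus_z2 2 \<star> X) (m, n) v =
    X (m - 2, n) v - (X (m - 1, n - 1) v + X (m - 1, n - 1) v) + X (m, n - 2) v"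
proof -
  have sq: "spow z1_minus_z2 2 = z1_minus_z2 \<star> (z1_minus_z2 \<star> sone)"
    by (simp add: spow_def sprod_def numeral_2_eq_2)
  have sq': "spow z1_minus_z2 2 (i, j) w =
      (if (i, j) = (2, 0) then w else if (i, j) = (1, 1) then - (w + w) else if (i, j) = (0, 2) then w else 0)"
    for i j w
    unfolding sq z1_minus_z2_smul by (auto simp: sone_def zero_prod_def)
  have "(spow z1_minus_z2 2 \<star> X) (m, n) v =
      (\<Sum>i\<in>{(2, 0), (1, 1), (0, 2)}. spow z1_minus_z2 2 i (X ((m, n) - i) v))"
    unfolding smul_def[of "spow _ _"] by (rule Sum_any.expand_superset) (auto simp: sq' split: if_splits)
  then show ?thesis
    by (simp add: sq' algebra_simps)
qed

text \<open>In distinct variables each pair of exponents arises in exactly one way, so composing two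
  currents raises no question of convergence.\<close>

lemma at_var_Z1_Z2_smul:
  assumes "additive_series A" "additive_series B"
  shows "(at_var Z1 A \<star> at_var Z2 B) (m, n) v = A m (B n v)"
proof -
  have *: "(\<lambda>i. A i (at_var Z2 B (m - i, n) v)) = (\<lambda>i. if i = m then A i (B n v) else 0)"
    by (auto simp: fun_eq_iff additive_series_0[OF assms(1)])
  show ?thesis
    unfolding at_var_Z1_smul[OF assms(1)] * by (rule Sum_any.delta)
qed

lemma at_var_Z2_Z1_smul:
  assumes "additive_series A" "additive_series B"
  shows "(at_var Z2 A \<star> at_var Z1 B) (m, n) v = A n (B m v)"
proof -
  have *: "(\<lambda>i. A i (at_var Z1 B (m, n - i) v)) = (\<lambda>i. if i = n then A i (B m v) else 0)"
    by (auto simp: fun_eq_iff additive_series_0[OF assms(1)])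
  show ?thesis
    unfolding at_var_Z2_smul[OF assms(1)] * by (rule Sum_any.delta)
qed

text \<open>Every vector is a finite sum of homogeneous ones, so formulas proved for a fixed weight
  extend by additivity.\<close>

lemma additive_maps_eqI:
  fixes f g :: "L \<Rightarrow> L"
  assumes "\<And>u v. f (u + v) = f u + f v" "\<And>u v. g (u + v) = g u + g v"
    and "\<And>k p. f (Poly_Mapping.single k p) = g (Poly_Mapping.single k p)"
  shows "f v = g v"
proof (induction v rule: single_sum_induct)
  case zero
  show ?case using assms(3)[of 0 0] by simp
qed (simp_all add: assms)

theorem proposition2p2:
  "at_var Z1 x_hat \<star> at_var Z2 x_hat = at_var Z2 x_hat \<star> at_var Z1 x_hat \<and>
   at_var Z2 x_hat \<star> at_var Z1 x_hat =
     spow z1_minus_z2 2 \<star>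
       normal_product (map (Pair Z1) x_hat_factors @ map (Pair Z2) x_hat_factors)"
proof -
  note x = at_var_Z1_Z2_smul[OF additive_x_hat additive_x_hat]
    at_var_Z2_Z1_smul[OF additive_x_hat additive_x_hat]
  let ?N = "normal_product (map (Pair Z1) x_hat_factors @ map (Pair Z2) x_hat_factors)"
  have x_add: "x_hat n (u + v) = x_hat n u + x_hat n v" for n u v
    using additive_x_hat by (simp add: additive_series_def)
  have N_add: "?N e (u + v) = ?N e u + ?N e v" for e u v
    using additive_normal_product unfolding additive_series_def by blast
  \<comment> \<open>In the three-term formula, interchanging m and n exchanges the outer terms and
    fixes the middle one, up to the symmetry of \<open>normal_coeff\<close>.\<close>
  have comm: "x_hat m (x_hat n v) = x_hat n (x_hat m v)" for m n v
  proof (rule additive_maps_eqI[of "\<lambda>v. x_hat m (x_hat n v)" "\<lambda>v. x_hat n (x_hat m v)"])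
    fix k p
    show "x_hat m (x_hat n (Poly_Mapping.single k p)) = x_hat n (x_hat m (Poly_Mapping.single k p))"
      unfolding x_hat_x_hat_homogeneous[OF homogeneous_single]
      using normal_coeff_swap[of k _ m "n - 2"] normal_coeff_swap[of k _ n "m - 2"]
        normal_coeff_swap[of k _ "m - 1" "n - 1"]
      by simp
  qed (simp_all add: x_add)
  have norm: "x_hat m (x_hat n v) = (spow z1_minus_z2 2 \<star> ?N) (m, n) v" for m n v
    unfolding spow_z1_minus_z2_smul
  proof (rule additive_maps_eqI[of "\<lambda>v. x_hat m (x_hat n v)"])
    fix k p
    show "x_hat m (x_hat n (Poly_Mapping.single k p)) =
        ?N (m - 2, n) (Poly_Mapping.single k p)
        - (?N (m - 1, n - 1) (Poly_Mapping.single k p) + ?N (m - 1, n - 1) (Poly_Mapping.single k p))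
        + ?N (m, n - 2) (Poly_Mapping.single k p)"
      unfolding x_hat_x_hat_homogeneous[OF homogeneous_single]
        normal_product_homogeneous[OF homogeneous_single] ..
  qed (simp_all add: x_add N_add algebra_simps)
  show ?thesis
  proof (intro conjI ext)
    fix e :: "int \<times> int" and v
    obtain m n where e: "e = (m, n)" by fastforce
    show "(at_var Z1 x_hat \<star> at_var Z2 x_hat) e v = (at_var Z2 x_hat \<star> at_var Z1 x_hat) e v"
      unfolding e x by (rule comm)
    \<comment> \<open>\<open>norm\<close> has the current in z1 acting last, hence the preliminary
      exchange by \<open>comm\<close>.\<close>
    show "(at_var Z2 x_hat \<star> at_var Z1 x_hat) e v = (spow z1_minus_z2 2 \<star> ?N) e v"
      unfolding e x comm[of n] by (rule norm)
  qed
qed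

end
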